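(* Let $p,n\ge1$, $d_1\ge\cdots\ge d_p>0$, $D=\mathrm{diag}(d_1,\dots,d_p)$. Suppose $(X',Z')'\in\mathbb{R}^p\times\mathbb{R}^n$ has density $\prod_i d_i^{-1/2}\,\eta^{(p+n)/2} f(\eta\{(x-\theta)'D^{-1}(x-\theta)+z'z\})$, where $\theta\in\mathbb{R}^p$ and $\eta=\sigma^{-2}>0$ are unknown, and let $S=Z'Z$, $W=X'D^{-1}X/S$. Let $-p/2-1<a<-1$ and $e>-p/2-n/2-2$, and put on $(\theta,\eta)$ the improper prior density proportional to $(\theta'D^{-1}\theta)^{-p/2-a-1}\eta^{-a-1+e}$. Suppose $\int_0^\infty \eta^{(n+p)/2-a+e}f(\eta)\,d\eta<\infty$. Then the generalized Bayes estimator of $\theta$ under the loss $\eta(\delta-\theta)'(\delta-\theta)$ does not depend on $f$, and hence equals the generalized Bayes estimator in the normal case (which is well defined for these $a$ and $e$), namely $$\left(1-\frac{\phi(W)}{W}\right)X,\qquad \phi(w)=w\,\frac{\int_0^1 t^{p/2+a+1}(1-t)^{-a-2}(1+wt)^{-p/2-n/2-e-2}\,dt}{\int_0^1 t^{p/2+a}(1-t)^{-a-2}(1+wt)^{-p/2-n/2-e-2}\,dt}.$$ In particular, if $e=-n/2-1$, the estimator is $$\left(1-\frac{\alpha}{\alpha+1+W}\right)X,\qquad \alpha=\frac{p/2+a+1}{-a-1},$$ and $\alpha$ can take any positive value as $a$ ranges over $(-p/2-1,-1)$.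
   Context: Here $f:[0,\infty)\to[0,\infty)$ is a fixed function such that the displayed expression is a probability density. The generalized Bayes estimator under the loss $\eta(\delta-\theta)'(\delta-\theta)$ is $E(\eta\theta\mid X,S)/E(\eta\mid X,S)$, i.e. the ratio $$\frac{\int_{\mathbb{R}^p}\int_0^\infty\theta\,\eta^{(n+p)/2-a+e}f(\eta\{(X-\theta)'D^{-1}(X-\theta)+S\})(\theta'D^{-1}\theta)^{-p/2-a-1}\,d\eta\,d\theta}{\int_{\mathbb{R}^p}\int_0^\infty\eta^{(n+p)/2-a+e}f(\eta\{(X-\theta)'D^{-1}(X-\theta)+S\})(\theta'D^{-1}\theta)^{-p/2-a-1}\,d\eta\,d\theta}.$$ The prior arises as the $(\theta,\eta)$-marginal of the hierarchical prior $\theta\mid\lambda,\eta\sim N_p(0,\eta^{-1}(\lambda^{-1}-1)D)$, $\lambda\propto\lambda^a(1-\lambda)^{-a-2}$ on $[0,1]$, $\eta\propto\eta^e$ on $(0,\infty)$.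
   Formalization: For -p/2-n/2-2 < e <= -p/2-n/2-3/2 the numerator integral of the estimator does not converge absolutely, so it is read as the limit of integrals over |θ|<=R as R→∞; for larger e it is the ordinary integral. *)

theory Defs
  imports "HOL-Analysis.Analysis"
begin

definition diag_mat :: "('p::finite \<Rightarrow> real) \<Rightarrow> real^'p^'p"
  where "diag_mat d = (\<chi> i j. if i = j then d i else 0)"

definition mahal :: "('p::finite \<Rightarrow> real) \<Rightarrow> real^'p \<Rightarrow> real"
  where "mahal d x = x \<bullet> (matrix_inv (diag_mat d) *v x)"

definition is_prob_density :: "('a::euclidean_space \<Rightarrow> real) \<Rightarrow> bool"
  where "is_prob_density g \<longleftrightarrow>
    g \<in> borel_measurable lborel \<and> (\<forall>y. 0 \<le> g y) \<and> (\<integral>\<^sup>+y. ennreal (g y) \<partial>lborel) = 1"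

definition model_density ::
  "('p::finite \<Rightarrow> real) \<Rightarrow> (real \<Rightarrow> real) \<Rightarrow> real^'p \<Rightarrow> real \<Rightarrow> real^'p \<Rightarrow> real^'n::finite \<Rightarrow> real"
  where "model_density d f \<theta> \<eta> x z =
    (\<Prod>i\<in>UNIV. d i powr (-1/2)) * \<eta> powr ((real CARD('p) + real CARD('n)) / 2)
      * f (\<eta> * (mahal d (x - \<theta>) + z \<bullet> z))"

definition gauss_profile :: "nat \<Rightarrow> real \<Rightarrow> real"
  where "gauss_profile k t = (2 * pi) powr (- real k / 2) * exp (- t / 2)"

definition prior_density ::
  "('p::finite \<Rightarrow> real) \<Rightarrow> real \<Rightarrow> real \<Rightarrow> real \<Rightarrow> real^'p \<Rightarrow> real \<Rightarrow> real"
  where "prior_density d a e c \<theta> \<eta> =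
    c * mahal d \<theta> powr (- real CARD('p) / 2 - a - 1) * \<eta> powr (- a - 1 + e)"

text \<open>Unnormalised posterior density of \<open>(\<theta>, \<eta>)\<close>.\<close>

definition posterior_kernel ::
  "('p::finite \<Rightarrow> real) \<Rightarrow> (real \<Rightarrow> real) \<Rightarrow> real \<Rightarrow> real \<Rightarrow> real \<Rightarrow> real^'p \<Rightarrow> real^'n::finite
    \<Rightarrow> real^'p \<Rightarrow> real \<Rightarrow> real"
  where "posterior_kernel d f a e c x z \<theta> \<eta> =
    model_density d f \<theta> \<eta> x z * prior_density d a e c \<theta> \<eta>"

text \<open>
  The generalized Bayes estimator for the loss \<open>\<eta> \<parallel>\<delta> - \<theta>\<parallel>\<^sup>2\<close> is
  \<open>E(\<eta> \<theta>) / E(\<eta>)\<close> under an unnormalised posterior density \<open>w\<close>; the total mass of \<open>w\<close>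
  cancels and is not required to be finite. The vector integral in the numerator need not
  converge absolutely when the denominator does, so it is read as the limit of
  the integrals over \<open>\<parallel>\<theta>\<parallel> \<le> R\<close>; by \<open>gb_estimator_absolute\<close> below this is the plain
  Lebesgue integral whenever the latter exists.
\<close>

definition gb_denominator :: "(real^'p::finite \<Rightarrow> real \<Rightarrow> real) \<Rightarrow> real"
  where "gb_denominator w =
    set_lebesgue_integral lborel (UNIV \<times> {0<..}) (\<lambda>(\<theta>, \<eta>). \<eta> * w \<theta> \<eta>)"

definition gb_numerator :: "(real^'p::finite \<Rightarrow> real \<Rightarrow> real) \<Rightarrow> real \<Rightarrow> real^'p"
  where "gb_numerator w R =
    set_lebesgue_integral lborel (cball 0 R \<times> {0<..}) (\<lambda>(\<theta>, \<eta>). (\<eta> * w \<theta> \<eta>) *\<^sub>R \<theta>)"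

definition gb_estimator :: "(real^'p::finite \<Rightarrow> real \<Rightarrow> real) \<Rightarrow> real^'p"
  where "gb_estimator w = (1 / gb_denominator w) *\<^sub>R Lim at_top (gb_numerator w)"

definition gb_well_defined :: "(real^'p::finite \<Rightarrow> real \<Rightarrow> real) \<Rightarrow> bool"
  where "gb_well_defined w \<longleftrightarrow>
    set_integrable lborel (UNIV \<times> {0<..}) (\<lambda>(\<theta>, \<eta>). \<eta> * w \<theta> \<eta>) \<and>
    0 < gb_denominator w \<and>
    (\<forall>R. set_integrable lborel (cball 0 R \<times> {0<..}) (\<lambda>(\<theta>, \<eta>). (\<eta> * w \<theta> \<eta>) *\<^sub>R \<theta>)) \<and>
    (\<exists>N. (gb_numerator w \<longlongrightarrow> N) at_top)"

definition gb_absolute :: "(real^'p::finite \<Rightarrow> real \<Rightarrow> real) \<Rightarrow> bool"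
  where "gb_absolute w \<longleftrightarrow>
    set_integrable lborel (UNIV \<times> {0<..}) (\<lambda>(\<theta>, \<eta>). (\<eta> * w \<theta> \<eta>) *\<^sub>R \<theta>)"

lemma gb_estimator_absolute:
  fixes w :: "real^'p::finite \<Rightarrow> real \<Rightarrow> real"
  assumes "gb_absolute w"
  shows "gb_estimator w = (1 / gb_denominator w) *\<^sub>R
    set_lebesgue_integral lborel (UNIV \<times> {0<..}) (\<lambda>(\<theta>, \<eta>). (\<eta> * w \<theta> \<eta>) *\<^sub>R \<theta>)"
proof -
  define g :: "(real^'p) \<times> real \<Rightarrow> real^'p" where
    "g = (\<lambda>y. indicator (UNIV \<times> {0<..}) y *\<^sub>R (case y of (\<theta>, \<eta>) \<Rightarrow> (\<eta> * w \<theta> \<eta>) *\<^sub>R \<theta>))"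
  have g: "integrable lborel g"
    using assms by (simp add: gb_absolute_def set_integrable_def g_def)
  have num: "gb_numerator w = (\<lambda>R. \<integral>y. indicator (cball 0 R \<times> UNIV) y *\<^sub>R g y \<partial>lborel)"
    unfolding gb_numerator_def set_lebesgue_integral_def g_def
    by (intro ext Bochner_Integration.integral_cong refl)
      (auto simp: indicator_def split: if_splits)
  have "((\<lambda>R. \<integral>y. indicator (cball 0 R \<times> UNIV) y *\<^sub>R g y \<partial>lborel) \<longlongrightarrow>
      (\<integral>y. g y \<partial>lborel)) at_top"
  proof (rule integral_dominated_convergence_at_top[where w = "\<lambda>y. norm (g y)"])
    have [measurable]: "cball (0::real^'p) R \<times> (UNIV::real set) \<in> sets borel" for R
      by (intro borel_closed closed_Times) auto
    show "(\<lambda>y. indicator (cball 0 R \<times> UNIV) y *\<^sub>R g y) \<in> borel_measurable lborel" for R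
      using borel_measurable_integrable[OF g] by measurable
    show "AE y in lborel. ((\<lambda>R. indicator (cball 0 R \<times> UNIV) y *\<^sub>R g y) \<longlongrightarrow> g y) at_top"
    proof (rule AE_I2, rule tendsto_eventually)
      fix y :: "(real^'p) \<times> real"
      show "\<forall>\<^sub>F R in at_top. indicator (cball 0 R \<times> UNIV) y *\<^sub>R g y = g y"
        using eventually_ge_at_top[of "norm (fst y)"]
        by eventually_elim (auto simp: indicator_def mem_Times_iff)
    qed
  qed (use g in \<open>auto simp: indicator_def\<close>)
  then have "Lim at_top (gb_numerator w) = (\<integral>y. g y \<partial>lborel)"
    unfolding num by (intro tendsto_Lim) auto
  then show ?thesis
    by (simp add: gb_estimator_def g_def set_lebesgue_integral_def)
qed

text \<open>Integrals over \<open>[0, 1]\<close> in the closed form; \<open>p\<close> and \<open>n\<close> are the two dimensions.\<close>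

definition shrink_integral :: "real \<Rightarrow> real \<Rightarrow> real \<Rightarrow> real \<Rightarrow> real \<Rightarrow> real \<Rightarrow> real"
  where "shrink_integral b p n a e w =
    set_lebesgue_integral lborel {0..1}
      (\<lambda>t. t powr b * (1 - t) powr (- a - 2) * (1 + w * t) powr (- p / 2 - n / 2 - e - 2))"

definition phi :: "real \<Rightarrow> real \<Rightarrow> real \<Rightarrow> real \<Rightarrow> real \<Rightarrow> real"
  where "phi p n a e w =
    w * (shrink_integral (p / 2 + a + 1) p n a e w / shrink_integral (p / 2 + a) p n a e w)"

definition alpha :: "real \<Rightarrow> real \<Rightarrow> real"
  where "alpha p a = (p / 2 + a + 1) / (- a - 1)"

definition W_stat :: "('p::finite \<Rightarrow> real) \<Rightarrow> real^'p \<Rightarrow> real^'n::finite \<Rightarrow> real"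
  where "W_stat d x z = mahal d x / (z \<bullet> z)"

end

theory Submission
  imports Defs "HOL-Probability.Distributions"
begin

text \<open>
  Write \<open>q \<theta> = (x - \<theta>)'D\<^sup>-\<^sup>1(x - \<theta>) + s\<close> with \<open>s = z'z\<close>. For fixed \<open>\<theta>\<close>, rescaling \<open>\<eta>\<close> by \<open>q \<theta>\<close>
  turns the \<open>\<eta>\<close>-integral into a moment of \<open>f\<close>, which cancels in the quotient, times
  \<open>h \<theta> = (\<theta>'D\<^sup>-\<^sup>1\<theta>) powr - b * q \<theta> powr - k\<close>. So the estimator is the mean of \<open>h\<close>, whatever \<open>f\<close> is.
  By two Gamma integrals \<open>h\<close> is a mixture over \<open>l \<in> (0,1)\<close> and \<open>v > 0\<close> of
  \<open>exp (- v (q \<theta> + l / (1 - l) \<theta>'D\<^sup>-\<^sup>1\<theta>))\<close>, which, completing the square, is a Gaussian in \<open>\<theta>\<close>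
  with mean \<open>(1 - l) x\<close>. Integrating out \<open>\<theta>\<close>, then \<open>v\<close>, leaves the integrals over \<open>l\<close> in \<open>\<phi>\<close>.

  The numerator is only conditionally convergent in general. As balls are symmetric, \<open>h \<theta> *\<^sub>R \<theta>\<close> may
  be replaced by \<open>(h \<theta> - h (- \<theta>)) *\<^sub>R \<theta> / 2\<close>, which is absolutely integrable because
  \<open>\<parallel>\<theta>\<parallel> \<bar>q \<theta> - q (- \<theta>)\<bar>\<close> is bounded by a multiple of \<open>q \<theta>\<close>.
\<close>

subsection \<open>Affine substitution and the quadratic form\<close>

text \<open>\<open>lborel\<close> is the push-forward of itself under
  \<open>x \<mapsto> t + c *\<^sub>R x\<close>, with density \<open>\<bar>c\<bar> ^ DIM('a)\<close>.
  The form for vector-valued integrands serves scalings, translations and the reflection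
  \<open>c = -1\<close>.\<close>

lemma lborel_has_bochner_integral_affine:
  fixes f :: "'a::euclidean_space \<Rightarrow> 'b::{banach, second_countable_topology}"
  assumes f: "has_bochner_integral lborel f I" and c: "c \<noteq> 0"
  shows "has_bochner_integral lborel (\<lambda>x. f (t + c *\<^sub>R x)) (I /\<^sub>R \<bar>c\<bar> ^ DIM('a))"
proof -
  have [measurable]: "f \<in> borel_measurable borel"
    using f by (auto simp: has_bochner_integral_iff dest: borel_measurable_integrable)
  have aff: "lborel = density (distr lborel borel (\<lambda>x::'a. t + c *\<^sub>R x)) (\<lambda>_. ennreal (\<bar>c\<bar> ^ DIM('a)))"
    using lborel_affine[OF c, of t] by (simp add: ennreal_power)
  have "integrable lborel (\<lambda>x. \<bar>c\<bar> ^ DIM('a) *\<^sub>R f (t + c *\<^sub>R x))"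
    using f by (subst (asm) aff) (auto simp: has_bochner_integral_iff integrable_density integrable_distr_eq)
  then have "integrable lborel (\<lambda>x. inverse (\<bar>c\<bar> ^ DIM('a)) *\<^sub>R (\<bar>c\<bar> ^ DIM('a) *\<^sub>R f (t + c *\<^sub>R x)))"
    by (rule integrable_scaleR_right)
  then have 1: "integrable lborel (\<lambda>x. f (t + c *\<^sub>R x))"
    using c by simp
  have "I = (\<integral>x. \<bar>c\<bar> ^ DIM('a) *\<^sub>R f (t + c *\<^sub>R x) \<partial>lborel)"
    using f by (subst (asm) aff) (auto simp: has_bochner_integral_iff integral_density integral_distr)
  then show ?thesis
    using 1 c by (simp add: has_bochner_integral_iff)
qed

lemma mahal_eq_sum:
  assumes "\<And>i. 0 < d i"
  shows "mahal d x = (\<Sum>i\<in>UNIV. (x $ i)\<^sup>2 / d i)"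
proof -
  let ?B = "diag_mat (\<lambda>i. 1 / d i)"
  have mul: "diag_mat u ** diag_mat v = diag_mat (\<lambda>i. u i * v i)" for u v :: "'a \<Rightarrow> real"
    by (auto simp: diag_mat_def matrix_matrix_mult_def vec_eq_iff if_distrib[of "\<lambda>t. t * _"]
        cong: if_cong)
  have one: "diag_mat (\<lambda>i. 1) = (mat 1 :: real^'a^'a)"
    by (simp add: diag_mat_def mat_def)
  have nz: "d i \<noteq> 0" for i
    using assms[of i] by simp
  have ex: "\<exists>A'. diag_mat d ** A' = mat 1 \<and> A' ** diag_mat d = mat 1"
    by (intro exI[of _ ?B]) (simp add: mul nz one)
  define C where "C = matrix_inv (diag_mat d)"
  \<comment> \<open>\<open>matrix_inv\<close> is a choice among two-sided inverses. Only the inverse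
    property is available for it, and uniqueness of inverses then identifies it with
    \<open>?B\<close>.\<close>
  have "diag_mat d ** C = mat 1 \<and> C ** diag_mat d = mat 1"
    using someI_ex[OF ex] by (simp add: C_def matrix_inv_def)
  then have "C = ?B"
    by (metis (no_types, lifting) ext matrix_mul_assoc matrix_mul_lid matrix_mul_rid mul one nz
        nonzero_divide_eq_eq)
  moreover have "?B *v x = (\<chi> i. x $ i / d i)"
    by (simp add: diag_mat_def matrix_vector_mult_def vec_eq_iff if_distrib[of "\<lambda>t. t * _"]
        cong: if_cong)
  ultimately show ?thesis
    by (simp add: mahal_def C_def inner_vec_def power2_eq_square)
qed

text \<open>The map \<open>D powr (-1/2)\<close>. It turns the quadratic form into a squared
  Euclidean norm, so that Cauchy-Schwarz and the triangle inequality apply.\<close>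

definition whiten :: "('p::finite \<Rightarrow> real) \<Rightarrow> real^'p \<Rightarrow> real^'p"
  where "whiten d x = (\<chi> i. x $ i / sqrt (d i))"

lemma linear_whiten: "linear (whiten d)"
  by (rule linearI) (auto simp: whiten_def vec_eq_iff add_divide_distrib)

lemma mahal_eq_norm:
  assumes "\<And>i. 0 < d i"
  shows "mahal d x = (norm (whiten d x))\<^sup>2"
  using assms by (simp add: mahal_eq_sum power2_norm_eq_inner inner_vec_def whiten_def
      power2_eq_square[symmetric] power_divide less_imp_le)

lemma borel_measurable_whiten [measurable]: "whiten d \<in> borel_measurable borel"
  by (intro borel_measurable_continuous_onI linear_continuous_on linear_linear[THEN iffD2] linear_whiten)

text \<open>The Euclidean norm is at most the l1 norm, and each coordinate satisfies \<bar>x_i\<bar>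
  = sqrt(d_i) \<bar>(whiten d x)_i\<bar>; hence the constant is the sum of the sqrt(d_i).\<close>

lemma norm_le_norm_whiten:
  assumes "\<And>i. 0 < d i"
  shows "\<exists>L>0. \<forall>x. norm x \<le> L * norm (whiten d x)"
proof -
  define L where "L = (\<Sum>i\<in>UNIV. sqrt (d i))"
  have pos: "0 < sqrt (d i)" for i using assms[of i] by simp
  have "0 < L" unfolding L_def by (intro sum_pos) (use pos in auto)
  moreover have "norm x \<le> L * norm (whiten d x)" for x :: "real^'a"
  proof -
    have "norm x \<le> (\<Sum>i\<in>UNIV. \<bar>x $ i\<bar>)" by (rule norm_le_l1_cart)
    also have "\<dots> \<le> (\<Sum>i\<in>UNIV. sqrt (d i) * norm (whiten d x))"
    proof (rule sum_mono)
      fix i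
      have "\<bar>x $ i\<bar> = sqrt (d i) * \<bar>whiten d x $ i\<bar>"
        using pos[of i] by (simp add: whiten_def abs_mult)
      also have "\<dots> \<le> sqrt (d i) * norm (whiten d x)"
        using pos[of i] by (intro mult_left_mono component_le_norm_cart) auto
      finally show "\<bar>x $ i\<bar> \<le> sqrt (d i) * norm (whiten d x)" .
    qed
    finally show ?thesis by (simp add: L_def sum_distrib_right)
  qed
  ultimately show ?thesis by blast
qed

subsection \<open>Gamma integrals\<close>

text \<open>Euler's integral after the substitution \<open>t = r * v\<close>, whose factors
  \<open>r\<close> and \<open>r powr (b - 1)\<close> combine to \<open>r powr b\<close>. It is
  stated as a nonnegative integral for use with Tonelli.\<close>

lemma nn_integral_powr_exp:
  fixes b r :: real
  assumes b: "0 < b" and r: "0 < r"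
  shows "(\<integral>\<^sup>+v. ennreal (indicator {0<..} v * (v powr (b - 1) * exp (- (r * v)))) \<partial>lborel)
    = ennreal (Gamma b * r powr (- b))"
proof -
  have "ennreal (Gamma b) = (\<integral>\<^sup>+t. ennreal (indicator {0..} t * t powr (b - 1) / exp t) \<partial>lborel)"
    using b by (rule Gamma_conv_nn_integral_real)
  also have "\<dots> = ennreal r * (\<integral>\<^sup>+v. ennreal (indicator {0..} (r * v) * (r * v) powr (b - 1) / exp (r * v)) \<partial>lborel)"
    using r by (subst nn_integral_real_affine[where t = 0 and c = r]) auto
  also have "\<dots> = ennreal r * (\<integral>\<^sup>+v. ennreal (r powr (b - 1)) *
      ennreal (indicator {0<..} v * (v powr (b - 1) * exp (- (r * v)))) \<partial>lborel)"
    using r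
    by (intro arg_cong2[where f = "(*)"] refl nn_integral_cong_AE AE_I2)
      (auto simp: indicator_def ennreal_mult'[symmetric] powr_mult exp_minus field_simps
        zero_le_mult_iff)
  also have "\<dots> = ennreal (r powr b) * (\<integral>\<^sup>+v. 
      ennreal (indicator {0<..} v * (v powr (b - 1) * exp (- (r * v)))) \<partial>lborel)"
    using r by (subst nn_integral_cmult)
      (auto simp: mult.assoc[symmetric] ennreal_mult'[symmetric] powr_mult_base)
  finally have *: "ennreal (Gamma b) = ennreal (r powr b) * (\<integral>\<^sup>+v. 
      ennreal (indicator {0<..} v * (v powr (b - 1) * exp (- (r * v)))) \<partial>lborel)" .
  have "ennreal (Gamma b * r powr (- b)) = ennreal (r powr (- b)) * ennreal (Gamma b)"
    using r b by (simp add: ennreal_mult'[symmetric] mult.commute)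
  also have "\<dots> = (\<integral>\<^sup>+v. 
      ennreal (indicator {0<..} v * (v powr (b - 1) * exp (- (r * v)))) \<partial>lborel)"
    using r by (subst *) (simp add: mult.assoc[symmetric] ennreal_mult'[symmetric] powr_add[symmetric])
  finally show ?thesis ..
qed

text \<open>The substitution \<open>g = l / (1 - l)\<close> in the Gamma integral.\<close>

lemma nn_integral_powr_exp_odds:
  fixes b r :: real
  assumes b: "0 < b" and r: "0 < r"
  shows "(\<integral>\<^sup>+l. ennreal (indicator {0<..<1} l *
      (l powr (b - 1) * (1 - l) powr (- b - 1) * exp (- (r * (l / (1 - l)))))) \<partial>lborel)
    = ennreal (Gamma b * r powr (- b))"
proof -
  define f where "f u = u powr (b - 1) * exp (- (r * u))" for u :: real
  let ?g = "\<lambda>l::real. l / (1 - l)"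
  let ?g' = "\<lambda>l::real. 1 / (1 - l)\<^sup>2"
  have f0: "0 \<le> f u" for u by (simp add: f_def)
  have [measurable]: "f \<in> borel_measurable borel" unfolding f_def by measurable
  have img: "?g ` {0<..<1} = {0<..}"
  proof (intro set_eqI iffI)
    fix u :: real assume "u \<in> {0<..}"
    then show "u \<in> ?g ` {0<..<1}"
      by (intro image_eqI[of _ _ "u / (1 + u)"]) (auto simp: field_simps)
  qed auto
  have nnf: "(\<integral>\<^sup>+u. ennreal (indicator {0<..} u * f u) \<partial>lborel) = ennreal (Gamma b * r powr (- b))"
    unfolding f_def by (rule nn_integral_powr_exp[OF b r])
  have si: "set_integrable lborel {0<..} f"
    unfolding set_integrable_def using nnf f0
    by (intro integrableI_nonneg) (auto simp: mult_nonneg_nonneg)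
  have "ennreal (set_lebesgue_integral lborel {0<..} f) = ennreal (Gamma b * r powr (- b))"
    unfolding set_lebesgue_integral_def nnf[symmetric] using si f0
    by (subst nn_integral_eq_integral) (auto simp: set_integrable_def)
  then have val: "set_lebesgue_integral lborel {0<..} f = Gamma b * r powr (- b)"
    using b f0 by (subst (asm) ennreal_inj)
      (auto simp: set_lebesgue_integral_def intro!: Bochner_Integration.integral_nonneg mult_nonneg_nonneg Gamma_real_nonneg)
  \<comment> \<open>The change of variables rule is stated for the gauge integral, so the value is
    carried over to that integral and back afterwards.\<close>
  have "f absolutely_integrable_on {0<..} \<and> integral {0<..} f = Gamma b * r powr (- b)"
    using set_borel_integral_eq_integral(2)[OF si] val si
    by (auto simp: set_integrable_def intro!: integrable_completion[THEN iffD2])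
  then have abs: "(\<lambda>l. \<bar>?g' l\<bar> * f (?g l)) absolutely_integrable_on {0<..<1} \<and>
      integral {0<..<1} (\<lambda>l. \<bar>?g' l\<bar> * f (?g l)) = Gamma b * r powr (- b)"
    unfolding img[symmetric]
  proof (rule has_absolute_integral_change_of_variables_1'[THEN iffD2, rotated -1])
    show "(?g has_field_derivative ?g' l) (at l within {0<..<1})" if "l \<in> {0<..<1}" for l
      using that by (auto intro!: derivative_eq_intros simp: power2_eq_square)
    show "inj_on ?g {0<..<1}"
      by (auto simp: inj_on_def frac_eq_eq algebra_simps)
  qed auto
  have "((\<lambda>l. \<bar>?g' l\<bar> * f (?g l)) has_integral (Gamma b * r powr (- b))) {0<..<1}"
    using abs by (auto simp: has_integral_iff set_lebesgue_integral_eq_integral(1))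
  then have "(\<integral>\<^sup>+l. ennreal (indicator {0<..<1} l * (\<bar>?g' l\<bar> * f (?g l))) \<partial>lborel)
      = ennreal (Gamma b * r powr (- b))"
    by (intro nn_integral_has_integral_lebesgue) (auto simp: f0)
  also have "(\<integral>\<^sup>+l. ennreal (indicator {0<..<1} l * (\<bar>?g' l\<bar> * f (?g l))) \<partial>lborel) =
    (\<integral>\<^sup>+l. ennreal (indicator {0<..<1} l *
      (l powr (b - 1) * (1 - l) powr (- b - 1) * exp (- (r * (l / (1 - l)))))) \<partial>lborel)"
  proof (intro nn_integral_cong arg_cong[where f = ennreal])
    fix l :: real
    show "indicator {0<..<1} l * (\<bar>?g' l\<bar> * f (?g l)) = indicator {0<..<1} l *
      (l powr (b - 1) * (1 - l) powr (- b - 1) * exp (- (r * (l / (1 - l)))))"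
    proof (cases "l \<in> {0<..<1}")
      case True
      have "1 / (1 - l)\<^sup>2 = (1 - l) powr (- 2)"
        using True by (simp add: powr_minus powr_numeral field_simps)
      \<comment> \<open>The Jacobian contributes the exponent -2 and the denominator of the odds
        contributes -(b - 1); together they make -b - 1.\<close>
      moreover have "(1 - l) powr (- 2) * (l / (1 - l)) powr (b - 1) =
          l powr (b - 1) * (1 - l) powr (- b - 1)"
      proof -
        have "(1 - l) powr (- b - 1) = (1 - l) powr (- 2) / (1 - l) powr (b - 1)"
          by (subst powr_diff[symmetric]) (rule arg_cong[where f = "(powr) (1 - l)"], simp)
        then show ?thesis using True by (simp add: powr_divide)
      qed
      ultimately show ?thesis using True by (simp add: f_def)
    qed simp
  qed
  finally show ?thesis .
qed

subsection \<open>Gaussian integrals\<close>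

lemma ennreal_prod_less_top:
  fixes f :: "'a \<Rightarrow> ennreal"
  assumes "\<And>i. i \<in> A \<Longrightarrow> f i < top"
  shows "prod f A < top"
  using assms by (induction A rule: infinite_finite_induct) (auto simp: ennreal_mult_less_top)

text \<open>The integrand is a product over the coordinates, and each factor is a multiple of the
  normal density with variance d_i / 2.\<close>

lemma integrable_exp_mahal:
  fixes d :: "'p::finite \<Rightarrow> real"
  assumes d: "\<And>i. 0 < d i"
  shows "integrable lborel (\<lambda>x. exp (- mahal d x))"
proof -
  have 1: "integrable lborel (\<lambda>t. exp (- (t\<^sup>2 / d i)))" for i
  proof -
    have s: "0 < sqrt (d i / 2)" "(sqrt (d i / 2))\<^sup>2 = d i / 2" using d[of i] by auto
    have "integrable lborel (\<lambda>t. sqrt (2 * pi * (d i / 2)) * normal_density 0 (sqrt (d i / 2)) t)"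
      using s by auto
    then show ?thesis
      unfolding normal_density_def s using d[of i] by (simp add: real_sqrt_mult real_sqrt_divide)
  qed
  \<comment> \<open>The product formula for \<open>lborel\<close> is indexed by the vectors in
    \<open>Basis\<close>, so the coordinate index has to be recovered from its axis vector.\<close>
  define g where "g v t = exp (- (t\<^sup>2 / d (SOME i. v = axis i (1::real))))" for v :: "real^'p" and t :: real
  have ga: "g (axis i 1) t = exp (- (t\<^sup>2 / d i))" for i t
  proof -
    have "(SOME j. axis i (1::real) = axis j 1) = i"
      by (rule some_equality) (auto simp: axis_eq_axis)
    then show ?thesis by (simp add: g_def)
  qed
  have Bas: "Basis = range (\<lambda>i::'p. axis i (1::real))"
    by (auto simp: Basis_vec_def)
  have inj: "inj (\<lambda>i::'p. axis i (1::real))"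
    by (auto simp: inj_on_def axis_eq_axis)
  have ex: "exp (- mahal d x) = (\<Prod>v\<in>Basis. g v (x \<bullet> v))" for x
    unfolding Bas by (subst prod.reindex[OF inj])
      (simp add: ga inner_axis mahal_eq_sum[OF d] exp_sum[symmetric] sum_negf)
  have "(\<integral>\<^sup>+x. ennreal (exp (- mahal d x)) \<partial>lborel) = (\<Prod>v\<in>Basis. (\<integral>\<^sup>+t. ennreal (g v t) \<partial>lborel))"
    unfolding ex by (subst prod_ennreal[symmetric]; (subst nn_integral_lborel_prod)?) (auto simp: g_def)
  also have "\<dots> < top"
    unfolding Bas
    by (rule ennreal_prod_less_top) 
      (use 1 in \<open>auto simp: ga integrable_iff_bounded\<close>)
  finally show ?thesis
    by (intro integrableI_nonneg) (auto simp: mahal_eq_norm[OF d])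
qed

lemma whiten_scaleR: "whiten d (c *\<^sub>R u) = c *\<^sub>R whiten d u"
  and whiten_minus: "whiten d (- u) = - whiten d u"
  and whiten_diff: "whiten d (u - v) = whiten d u - whiten d v"
  by (auto simp: whiten_def vec_eq_iff diff_divide_distrib)

text \<open>The affine map \<open>u \<mapsto> sqrt \<beta> *\<^sub>R (u - m)\<close> reduces to
  \<open>\<beta> = 1\<close> and \<open>m = 0\<close>. The remaining constant stays an unevaluated
  integral, since it cancels in the estimator.\<close>

lemma has_bochner_integral_exp_mahal:
  fixes d :: "'p::finite \<Rightarrow> real"
  assumes d: "\<And>i. 0 < d i" and \<beta>: "0 < \<beta>"
  shows "has_bochner_integral lborel (\<lambda>u. exp (- (\<beta> * mahal d (u - m))))
    (\<beta> powr (- real CARD('p) / 2) * (\<integral>u. exp (- mahal d u) \<partial>lborel))"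
proof -
  have sc: "mahal d (c *\<^sub>R u) = c\<^sup>2 * mahal d u" for c u
    by (simp add: mahal_eq_norm[OF d] whiten_scaleR power_mult_distrib)
  have "has_bochner_integral lborel (\<lambda>u. exp (- mahal d ((- sqrt \<beta>) *\<^sub>R m + sqrt \<beta> *\<^sub>R u)))
      ((\<integral>u. exp (- mahal d u) \<partial>lborel) /\<^sub>R \<bar>sqrt \<beta>\<bar> ^ DIM(real^'p))"
    using \<beta> integrable_exp_mahal[OF d]
    by (intro lborel_has_bochner_integral_affine has_bochner_integral_integrable) auto
  moreover have "(- sqrt \<beta>) *\<^sub>R m + sqrt \<beta> *\<^sub>R u = sqrt \<beta> *\<^sub>R (u - m)" for u
    by (simp add: algebra_simps)
  moreover have "inverse (\<bar>sqrt \<beta>\<bar> ^ DIM(real^'p)) = \<beta> powr (- real CARD('p) / 2)"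
    using \<beta> by (simp add: powr_half_sqrt[symmetric] powr_minus powr_powr flip: powr_realpow)
  ultimately show ?thesis
    using \<beta> by (simp add: sc)
qed

lemma integral_exp_mahal_pos:
  assumes d: "\<And>i. 0 < d i"
  shows "0 < (\<integral>u. exp (- mahal d u) \<partial>lborel)"
proof -
  have "0 \<le> (\<integral>u. exp (- mahal d u) \<partial>lborel)" by simp
  moreover have "(\<integral>u. exp (- mahal d u) \<partial>lborel) \<noteq> 0"
    by (subst integral_nonneg_eq_0_iff_AE)
      (auto simp: integrable_exp_mahal[OF d] eventually_False ae_filter_eq_bot_iff)
  ultimately show ?thesis by linarith
qed

lemma mult_exp_minus_le: "t * exp (- t) \<le> (1::real)"
proof -
  have "t \<le> exp t" using exp_ge_add_one_self[of t] by linarith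
  then show ?thesis by (simp add: exp_minus field_simps)
qed

text \<open>Centred at the origin the integrand is odd, so its integral vanishes. Translating by
  \<open>m\<close> and adding \<open>m\<close> times the total mass gives the general case.\<close>

lemma has_bochner_integral_exp_mahal_scaleR:
  fixes d :: "'p::finite \<Rightarrow> real" and m :: "real^'p"
  assumes d: "\<And>i. 0 < d i" and \<beta>: "0 < \<beta>"
  shows "has_bochner_integral lborel (\<lambda>u. exp (- (\<beta> * mahal d (u - m))) *\<^sub>R u)
    ((\<beta> powr (- real CARD('p) / 2) * (\<integral>u. exp (- mahal d u) \<partial>lborel)) *\<^sub>R m)"
proof -
  note meas [measurable] = borel_measurable_whiten
  let ?g = "\<lambda>u. exp (- (\<beta> * mahal d u)) *\<^sub>R u"
  obtain L where L: "0 < L" "\<And>x. norm x \<le> L * norm (whiten d x)"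
    using norm_le_norm_whiten[of d] d by blast
  have int: "integrable lborel ?g"
  proof (rule Bochner_Integration.integrable_bound)
    \<comment> \<open>Half of the exponent is spent on the factor \<open>norm u\<close>, through
      norm u \<le> 1 + (norm u)^2 and \<open>t * exp (- t) \<le> 1\<close>; the other half remains
      integrable.\<close>
    show "integrable lborel (\<lambda>u. (1 + 2 * L\<^sup>2 / \<beta>) * exp (- (\<beta> / 2 * mahal d u)))"
      using has_bochner_integral_exp_mahal[where d = d and \<beta> = "\<beta> / 2" and m = 0] d \<beta>
      by (intro integrable_mult_right) (simp add: has_bochner_integral_iff)
    show "?g \<in> borel_measurable lborel"
      unfolding mahal_eq_norm[OF d] by measurable
    show "AE u in lborel. norm (?g u) \<le> norm ((1 + 2 * L\<^sup>2 / \<beta>) * exp (- (\<beta> / 2 * mahal d u)))"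
    proof (rule AE_I2)
      fix u
      define t where "t = \<beta> / 2 * mahal d u"
      have t0: "0 \<le> t" using \<beta> by (simp add: t_def mahal_eq_norm[OF d])
      have "norm u \<le> 1 + (norm u)\<^sup>2"
      proof -
        have "2 * norm u \<le> (norm u)\<^sup>2 + 1"
          using zero_le_power2[of "norm u - 1"] by (simp add: power2_diff)
        then show ?thesis using zero_le_power2[of "norm u"] by linarith
      qed
      also have "(norm u)\<^sup>2 \<le> L\<^sup>2 * mahal d u"
        using power_mono[OF L(2)[of u], of 2] by (simp add: mahal_eq_norm[OF d] power_mult_distrib)
      also have "\<dots> = 2 * L\<^sup>2 / \<beta> * t" using \<beta> by (simp add: t_def)
      finally have "norm u * exp (- t) \<le> (1 + 2 * L\<^sup>2 / \<beta> * t) * exp (- t)"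
        by (intro mult_right_mono) auto
      also have "\<dots> = exp (- t) + 2 * L\<^sup>2 / \<beta> * (t * exp (- t))"
        by (simp add: algebra_simps)
      also have "\<dots> \<le> 1 + 2 * L\<^sup>2 / \<beta> * 1"
        using t0 \<beta> by (intro add_mono mult_left_mono mult_exp_minus_le) auto
      finally have "norm u * exp (- t) * exp (- t) \<le> (1 + 2 * L\<^sup>2 / \<beta>) * exp (- t)"
        by (intro mult_right_mono) auto
      moreover have "exp (- (\<beta> * mahal d u)) = exp (- t) * exp (- t)"
        by (simp add: t_def flip: exp_add)
      ultimately show "norm (?g u) \<le> norm ((1 + 2 * L\<^sup>2 / \<beta>) * exp (- (\<beta> / 2 * mahal d u)))"
        using \<beta> by (simp add: t_def mult_ac)
    qed
  qed
  have neg: "mahal d (- u) = mahal d u" for u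
    by (simp add: mahal_eq_norm[OF d] whiten_minus)
  have "has_bochner_integral lborel (\<lambda>u. ?g (0 + (-1) *\<^sub>R u)) (integral\<^sup>L lborel ?g /\<^sub>R \<bar>-1\<bar> ^ DIM(real^'p))"
    by (intro lborel_has_bochner_integral_affine has_bochner_integral_integrable int) auto
  then have "integral\<^sup>L lborel (\<lambda>u. - ?g u) = integral\<^sup>L lborel ?g"
    by (simp add: neg has_bochner_integral_iff)
  then have "integral\<^sup>L lborel ?g = 0"
    using int by (simp add: vec_eq_iff)
  then have "has_bochner_integral lborel ?g 0"
    using int by (simp add: has_bochner_integral_iff)
  then have "has_bochner_integral lborel (\<lambda>u. ?g (- m + 1 *\<^sub>R u)) (0 /\<^sub>R \<bar>1\<bar> ^ DIM(real^'p))"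
    by (rule lborel_has_bochner_integral_affine) simp
  then have "has_bochner_integral lborel (\<lambda>u. exp (- (\<beta> * mahal d (u - m))) *\<^sub>R (u - m)) 0"
    by simp
  moreover have "has_bochner_integral lborel (\<lambda>u. exp (- (\<beta> * mahal d (u - m))) *\<^sub>R m)
      ((\<beta> powr (- real CARD('p) / 2) * (\<integral>u. exp (- mahal d u) \<partial>lborel)) *\<^sub>R m)"
    by (intro has_bochner_integral_scaleR_left has_bochner_integral_exp_mahal d \<beta>)
  ultimately have "has_bochner_integral lborel
      (\<lambda>u. exp (- (\<beta> * mahal d (u - m))) *\<^sub>R (u - m) + exp (- (\<beta> * mahal d (u - m))) *\<^sub>R m)
      (0 + (\<beta> powr (- real CARD('p) / 2) * (\<integral>u. exp (- mahal d u) \<partial>lborel)) *\<^sub>R m)"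
    by (rule has_bochner_integral_add)
  then show ?thesis by (simp flip: scaleR_add_right)
qed

lemma mahal_pos:
  assumes "\<And>i. 0 < d i" "\<theta> \<noteq> 0"
  shows "0 < mahal d \<theta>"
proof -
  obtain L where "0 < L" "\<And>u. norm u \<le> L * norm (whiten d u)"
    using norm_le_norm_whiten[of d] assms(1) by blast
  then have "0 < L * norm (whiten d \<theta>)"
    using assms(2) by (metis order.strict_trans2 zero_less_norm_iff)
  then show ?thesis
    using \<open>0 < L\<close> by (simp add: mahal_eq_norm[OF assms(1)] zero_less_mult_iff)
qed

text \<open>A mean value bound. The sum of the two exponentials replaces their maximum, which keeps
  the bound symmetric in the two points.\<close>

lemma abs_exp_minus_diff_le: "\<bar>exp (- a) - exp (- b)\<bar> \<le> \<bar>a - b\<bar> * (exp (- a) + exp (- (b::real)))"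
proof -
  have *: "\<bar>exp (- a) - exp (- b)\<bar> \<le> \<bar>a - b\<bar> * (exp (- a) + exp (- b))" if "a \<le> b" for a b :: real
  proof -
    have "exp (- a) - exp (- b) = exp (- a) * (1 - exp (- (b - a)))"
      by (simp add: algebra_simps flip: exp_add)
    also have "\<dots> \<le> exp (- a) * (b - a)"
    proof (rule mult_left_mono)
      show "1 - exp (- (b - a)) \<le> b - a"
        using exp_ge_add_one_self[of "- (b - a)"] by linarith
    qed simp
    also have "\<dots> \<le> (b - a) * (exp (- a) + exp (- b))"
      using that by (simp add: algebra_simps)
    finally show ?thesis using that by simp
  qed
  show ?thesis using *[of a b] *[of b a] by (cases "a \<le> b") (auto simp: abs_minus_commute add.commute)
qed

text \<open>Half of the decay absorbs the factor \<open>t\<close>.\<close>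

lemma mult_exp_minus_le_half: "t * exp (- t) \<le> 2 * exp (- (t / 2 :: real))"
proof -
  have "t * exp (- t) = 2 * ((t / 2) * exp (- (t / 2))) * exp (- (t / 2))"
    by (simp flip: exp_add)
  also have "\<dots> \<le> 2 * 1 * exp (- (t / 2))"
    by (intro mult_right_mono mult_left_mono mult_exp_minus_le) auto
  finally show ?thesis by simp
qed

subsection \<open>The Gaussian mixture\<close>

text \<open>Here \<open>s\<close> is z'z, \<open>- b\<close> is the exponent of the quadratic form
  in the prior, and \<open>k - 1\<close> is the power of \<eta> in the integrand. Near the origin
  \<open>h\<close> below grows like norm \<theta> to the power -2 b, and at infinity it decays like
  norm \<theta> to the power -2 (k + b). The bounds \<open>b_less\<close> and \<open>k_large\<close>
  are integrability at these two ends; \<open>b_pos\<close> is for the Gamma integral.\<close>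

locale elliptical =
  fixes d :: "'p::finite \<Rightarrow> real" and x :: "real^'p" and s b k :: real
  assumes d_pos: "\<And>i. 0 < d i" and s_pos: "0 < s" and b_pos: "0 < b"
    and b_less: "b < real CARD('p) / 2" and k_large: "real CARD('p) / 2 < k + b"
begin

definition q :: "real^'p \<Rightarrow> real" where "q \<theta> = mahal d (x - \<theta>) + s"

definition h :: "real^'p \<Rightarrow> real" where "h \<theta> = mahal d \<theta> powr (- b) * q \<theta> powr (- k)"

text \<open>The mixing density. In terms of the odds g = l / (1 - l) its first factor is g^(b - 1)
  dg, and \<open>l\<close> corresponds to the hyperparameter \<lambda> of the hierarchical prior.
  The exponent of \<open>v\<close> exceeds \<open>k - 1\<close> by \<open>b\<close>, because
  integrating over \<open>l\<close> yields \<open>v powr (- b)\<close>.\<close>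

definition \<rho> :: "real \<times> real \<Rightarrow> real" where
  "\<rho> = (\<lambda>(l, v). indicator {0<..<1} l * (l powr (b - 1) * (1 - l) powr (- b - 1)) *
    (indicator {0<..} v * v powr (k + b - 1)))"

text \<open>The mixed kernel itself is \<open>E 1\<close>. The rate \<tau> is kept free because the
  dominating function for the numerator is made of \<open>E (1/2)\<close>.\<close>

definition E :: "real \<Rightarrow> real^'p \<Rightarrow> real \<times> real \<Rightarrow> real" where
  "E \<tau> \<theta> = (\<lambda>(l, v). exp (- (\<tau> * v * (q \<theta> + l / (1 - l) * mahal d \<theta>))))"

lemma k_pos: "0 < k" using b_less k_large by linarith

lemmas mahal_norm = mahal_eq_norm[OF d_pos]

lemma mahal_nonneg: "0 \<le> mahal d \<theta>" by (simp add: mahal_norm)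

lemma q_ge: "s \<le> q \<theta>" by (simp add: q_def mahal_nonneg)

lemma q_pos: "0 < q \<theta>" using q_ge[of \<theta>] s_pos by linarith

lemma measurable_mahal [measurable]: "mahal d \<in> borel_measurable borel"
  unfolding mahal_norm[abs_def] by measurable

lemma measurable_q [measurable]: "q \<in> borel_measurable borel"
  unfolding q_def[abs_def] by measurable

lemma measurable_h [measurable]: "h \<in> borel_measurable borel"
  unfolding h_def[abs_def] by measurable

lemma measurable_\<rho> [measurable]: "\<rho> \<in> borel_measurable borel"
  unfolding \<rho>_def borel_prod[symmetric] by measurable

lemma measurable_E [measurable (raw)]:
  assumes [measurable]: "f \<in> borel_measurable M" "g \<in> borel_measurable M"
  shows "(\<lambda>w. E \<tau> (f w) (g w)) \<in> borel_measurable M"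
proof -
  have [measurable]: "g \<in> M \<rightarrow>\<^sub>M borel \<Otimes>\<^sub>M borel"
    using assms(2) by (simp add: borel_prod)
  show ?thesis unfolding E_def split_beta by measurable
qed

lemma \<rho>_nonneg: "0 \<le> \<rho> w" by (auto simp: \<rho>_def split: prod.split)

lemma E_nonneg: "0 \<le> E \<tau> \<theta> w" by (auto simp: E_def split: prod.split)

lemma h_nonneg: "0 \<le> h \<theta>" by (auto simp: h_def)

text \<open>Integrate over \<open>l\<close> first, with rate
  \<open>\<tau> * v * mahal d \<theta>\<close>: this produces
  \<open>mahal d \<theta> powr (- b)\<close> and lowers the exponent of \<open>v\<close> to
  \<open>k - 1\<close>. The integral over \<open>v\<close> with rate
  \<open>\<tau> * q \<theta>\<close> then gives \<open>q \<theta> powr (- k)\<close>.\<close>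

lemma nn_integral_\<rho>_E:
  assumes \<theta>: "\<theta> \<noteq> 0" and \<tau>: "0 < \<tau>"
  shows "(\<integral>\<^sup>+w. ennreal (\<rho> w * E \<tau> \<theta> w) \<partial>lborel) =
    ennreal (Gamma b * Gamma k * \<tau> powr (- (b + k)) * h \<theta>)"
proof -
  have eq: "ennreal (\<rho> (l, v) * E \<tau> \<theta> (l, v)) =
      ennreal (indicator {0<..} v * (v powr (k + b - 1) * exp (- (\<tau> * q \<theta> * v)))) *
      ennreal (indicator {0<..<1} l * (l powr (b - 1) * (1 - l) powr (- b - 1) *
        exp (- (\<tau> * v * mahal d \<theta> * (l / (1 - l))))))" for l v
    by (auto simp: \<rho>_def E_def indicator_def ennreal_mult'[symmetric] algebra_simps exp_add[symmetric] exp_diff[symmetric])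
  have inner: "(\<integral>\<^sup>+l. ennreal (\<rho> (l, v) * E \<tau> \<theta> (l, v)) \<partial>lborel) =
      ennreal (Gamma b * (\<tau> * mahal d \<theta>) powr (- b)) *
      ennreal (indicator {0<..} v * (v powr (k - 1) * exp (- (\<tau> * q \<theta> * v))))" for v
  proof (cases "0 < v")
    case True
    have r: "0 < \<tau> * v * mahal d \<theta>" using True mahal_pos[OF d_pos \<theta>] \<tau> by simp
    have "(\<integral>\<^sup>+l. ennreal (\<rho> (l, v) * E \<tau> \<theta> (l, v)) \<partial>lborel) =
      ennreal (v powr (k + b - 1) * exp (- (\<tau> * q \<theta> * v))) * ennreal (Gamma b * (\<tau> * v * mahal d \<theta>) powr (- b))"
      unfolding eq using True
      by (subst nn_integral_cmult, measurable)
        (subst nn_integral_powr_exp_odds[OF b_pos r], simp)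
    also have "(\<tau> * v * mahal d \<theta>) powr (- b) = (\<tau> * mahal d \<theta>) powr (- b) * v powr (- b)"
      using True \<tau> mahal_nonneg by (simp add: powr_mult mult.commute mult.left_commute)
    also have "ennreal (v powr (k + b - 1) * exp (- (\<tau> * q \<theta> * v))) *
        ennreal (Gamma b * ((\<tau> * mahal d \<theta>) powr (- b) * v powr (- b))) =
        ennreal (Gamma b * (\<tau> * mahal d \<theta>) powr (- b) * ((v powr (k + b - 1) * v powr (- b)) * exp (- (\<tau> * q \<theta> * v))))"
      by (subst ennreal_mult'[symmetric]) (simp_all add: mult_ac)
    also have "v powr (k + b - 1) * v powr (- b) = v powr (k - 1)"
      by (simp add: powr_add[symmetric])
    finally show ?thesis
      using True b_pos by (subst ennreal_mult'[symmetric]) (auto simp: mult_ac)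
  qed (simp add: \<rho>_def)
  have "(\<integral>\<^sup>+w. ennreal (\<rho> w * E \<tau> \<theta> w) \<partial>lborel) =
      (\<integral>\<^sup>+v. \<integral>\<^sup>+l. ennreal (\<rho> (l, v) * E \<tau> \<theta> (l, v)) \<partial>lborel \<partial>lborel)"
    unfolding lborel_prod[symmetric]
    by (subst lborel_pair.nn_integral_snd[symmetric]) (auto simp: lborel_prod)
  also have "\<dots> = ennreal (Gamma b * (\<tau> * mahal d \<theta>) powr (- b)) * ennreal (Gamma k * (\<tau> * q \<theta>) powr (- k))"
    unfolding inner using \<tau> q_pos[of \<theta>]
    by (subst nn_integral_cmult) (auto simp: nn_integral_powr_exp[OF k_pos])
  also have "\<dots> = ennreal (Gamma b * Gamma k * \<tau> powr (- (b + k)) * h \<theta>)"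
  proof -
    have "(\<tau> * mahal d \<theta>) powr (- b) = \<tau> powr (- b) * mahal d \<theta> powr (- b)"
      "(\<tau> * q \<theta>) powr (- k) = \<tau> powr (- k) * q \<theta> powr (- k)"
      using \<tau> q_pos[of \<theta>] mahal_nonneg[of \<theta>] by (simp_all add: powr_mult)
    moreover have "\<tau> powr (- (b + k)) = \<tau> powr (- b) * \<tau> powr (- k)"
      by (simp add: powr_add[symmetric])
    ultimately show ?thesis
      using b_pos by (subst ennreal_mult'[symmetric]) (simp_all add: h_def mult_ac)
  qed
  finally show ?thesis .
qed

section \<open>Integrating out \<open>\<theta>\<close>, then \<open>v\<close>\<close>

definition gauss_const :: real where "gauss_const = (\<integral>u. exp (- mahal d u) \<partial>lborel)"

text \<open>\<open>\<kappa> - 1\<close> is the exponent of \<open>v\<close> that is left once the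
  Gaussian integral over \<theta> has contributed -p/2.\<close>

definition \<kappa> :: real where "\<kappa> = k + b - real CARD('p) / 2"

text \<open>The integral of \<open>E 1 \<theta> (l, v)\<close> over \<theta>, for
  \<open>(l, v)\<close> in the support of \<open>\<rho>\<close>.\<close>

definition J :: "real \<times> real \<Rightarrow> real" where
  "J = (\<lambda>(l, v). gauss_const * ((v / (1 - l)) powr (- real CARD('p) / 2) *
    exp (- (v * (l * mahal d x + s)))))"

text \<open>On the unit interval, the integral of \<open>\<rho> * J\<close> over \<open>v\<close>
  without the factor \<open>gauss_const * Gamma \<kappa>\<close>.\<close>

definition wt :: "real \<Rightarrow> real" where
  "wt l = l powr (b - 1) * (1 - l) powr (real CARD('p) / 2 - b - 1) * (l * mahal d x + s) powr (- \<kappa>)"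

lemma gauss_const_pos: "0 < gauss_const"
  unfolding gauss_const_def by (rule integral_exp_mahal_pos) (rule d_pos)

lemma \<kappa>_pos: "0 < \<kappa>" using k_large by (simp add: \<kappa>_def)

lemma J_nonneg: "0 \<le> J w"
  using gauss_const_pos by (auto simp: J_def split: prod.split)

lemma measurable_J [measurable]: "J \<in> borel_measurable borel"
  unfolding J_def borel_prod[symmetric] by measurable

lemma measurable_wt [measurable]: "wt \<in> borel_measurable borel"
  unfolding wt_def[abs_def] by measurable

text \<open>The precisions 1 (pulling towards \<open>x\<close>) and l / (1 - l) (pulling towards 0)
  add up to 1 / (1 - l), so the minimum lies at \<open>(1 - l) *\<^sub>R x\<close> and has the value
  \<open>l * mahal d x + s\<close>.\<close>

lemma complete_square:
  assumes l: "0 < l" "l < 1"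
  shows "q \<theta> + l / (1 - l) * mahal d \<theta> =
    1 / (1 - l) * mahal d (\<theta> - (1 - l) *\<^sub>R x) + (l * mahal d x + s)"
proof -
  define X T where "X = whiten d x" and "T = whiten d \<theta>"
  have "mahal d (\<theta> - (1 - l) *\<^sub>R x) = (T - (1 - l) *\<^sub>R X) \<bullet> (T - (1 - l) *\<^sub>R X)"
    "mahal d (x - \<theta>) = (X - T) \<bullet> (X - T)" "mahal d x = X \<bullet> X" "mahal d \<theta> = T \<bullet> T"
    unfolding mahal_norm power2_norm_eq_inner by (simp_all add: X_def T_def whiten_diff whiten_scaleR)
  then have "q \<theta> + l / (1 - l) * mahal d \<theta> = (X - T) \<bullet> (X - T) + s + l / (1 - l) * (T \<bullet> T)"
    "1 / (1 - l) * mahal d (\<theta> - (1 - l) *\<^sub>R x) + (l * mahal d x + s) =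
      1 / (1 - l) * ((T - (1 - l) *\<^sub>R X) \<bullet> (T - (1 - l) *\<^sub>R X)) + (l * (X \<bullet> X) + s)"
    by (simp_all add: q_def)
  moreover have "(X - T) \<bullet> (X - T) = X \<bullet> X - 2 * (X \<bullet> T) + T \<bullet> T"
    "(T - (1 - l) *\<^sub>R X) \<bullet> (T - (1 - l) *\<^sub>R X) = T \<bullet> T - 2 * (1 - l) * (X \<bullet> T) + (1 - l)\<^sup>2 * (X \<bullet> X)"
    by (simp_all add: inner_diff_left inner_diff_right inner_commute power2_eq_square)
  ultimately show ?thesis
    using l by (simp add: field_simps power2_eq_square)
qed

lemma measurable_fst_prod [measurable]: "fst \<in> borel_measurable (borel :: (real \<times> real) measure)"
  unfolding borel_prod[symmetric] by measurable

lemma E_eq: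
  assumes l: "0 < l" "l < 1"
  shows "E 1 \<theta> (l, v) = exp (- (v * (l * mahal d x + s))) *
    exp (- ((v / (1 - l)) * mahal d (\<theta> - (1 - l) *\<^sub>R x)))"
  unfolding E_def prod.case complete_square[OF l] by (simp add: algebra_simps flip: exp_add)

lemma \<rho>_eq_0: "\<not> (0 < l \<and> l < 1 \<and> 0 < v) \<Longrightarrow> \<rho> (l, v) = 0"
  by (auto simp: \<rho>_def indicator_def)

text \<open>The factor \<open>\<rho> w\<close> is kept inside so that every \<open>w\<close> is
  covered: on the support this is a Gaussian integral, and off it both sides vanish.\<close>

lemma has_bochner_integral_\<rho>_E: "has_bochner_integral lborel (\<lambda>\<theta>. \<rho> w * E 1 \<theta> w) (\<rho> w * J w)"
proof (cases w)
  case w: (Pair l v)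
  show ?thesis
  proof (cases "0 < l \<and> l < 1 \<and> 0 < v")
    case True
    then have "has_bochner_integral lborel (\<lambda>\<theta>. \<rho> w * (exp (- (v * (l * mahal d x + s))) *
      exp (- ((v / (1 - l)) * mahal d (\<theta> - (1 - l) *\<^sub>R x)))))
      (\<rho> w * (exp (- (v * (l * mahal d x + s))) * ((v / (1 - l)) powr (- real CARD('p) / 2) *
        (\<integral>u. exp (- mahal d u) \<partial>lborel))))"
      by (intro has_bochner_integral_mult_right has_bochner_integral_exp_mahal d_pos) auto
    then show ?thesis
      using True by (simp add: w E_eq J_def gauss_const_def mult_ac)
  qed (simp add: w \<rho>_eq_0 has_bochner_integral_zero)
qed

text \<open>The factor \<open>1 - fst w\<close> comes from the Gaussian's centre
  \<open>(1 - l) *\<^sub>R x\<close>.\<close>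

lemma has_bochner_integral_\<rho>_E_scaleR:
  "has_bochner_integral lborel (\<lambda>\<theta>. (\<rho> w * E 1 \<theta> w) *\<^sub>R \<theta>) (((1 - fst w) * (\<rho> w * J w)) *\<^sub>R x)"
proof (cases w)
  case w: (Pair l v)
  show ?thesis
  proof (cases "0 < l \<and> l < 1 \<and> 0 < v")
    case True
    then have "has_bochner_integral lborel (\<lambda>\<theta>. (\<rho> w * exp (- (v * (l * mahal d x + s)))) *\<^sub>R
      (exp (- ((v / (1 - l)) * mahal d (\<theta> - (1 - l) *\<^sub>R x))) *\<^sub>R \<theta>))
      ((\<rho> w * exp (- (v * (l * mahal d x + s)))) *\<^sub>R (((v / (1 - l)) powr (- real CARD('p) / 2) *
        (\<integral>u. exp (- mahal d u) \<partial>lborel)) *\<^sub>R ((1 - l) *\<^sub>R x)))"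
      by (intro has_bochner_integral_scaleR_right has_bochner_integral_exp_mahal_scaleR d_pos) auto
    then show ?thesis
      using True by (simp add: w E_eq J_def gauss_const_def mult_ac)
  qed (simp add: w \<rho>_eq_0 has_bochner_integral_zero)
qed

text \<open>For fixed \<open>l\<close> the integral over \<open>v\<close> is a Gamma integral of
  order \<kappa> with rate \<open>l * mahal d x + s\<close>. The weight \<psi> treats the
  denominator (\<psi> = 1) and the numerator (\<psi> l = 1 - l) at once.\<close>

lemma nn_integral_\<rho>_J:
  assumes [measurable]: "\<psi> \<in> borel_measurable borel" and \<psi>: "\<And>l. l \<in> {0<..<1} \<Longrightarrow> 0 \<le> \<psi> l"
  shows "(\<integral>\<^sup>+w. ennreal (\<psi> (fst w) * (\<rho> w * J w)) \<partial>lborel) =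
    ennreal (gauss_const * Gamma \<kappa>) * (\<integral>\<^sup>+l. ennreal (indicator {0<..<1} l * (\<psi> l * wt l)) \<partial>lborel)"
proof -
  have inner: "(\<integral>\<^sup>+v. ennreal (\<psi> l * (\<rho> (l, v) * J (l, v))) \<partial>lborel) =
      ennreal (gauss_const * Gamma \<kappa>) * ennreal (indicator {0<..<1} l * (\<psi> l * wt l))" for l
  proof (cases "l \<in> {0<..<1}")
    case True
    define r where "r = l * mahal d x + s"
    have r: "0 < r" using True s_pos mahal_nonneg[of x] by (auto simp: r_def intro!: add_nonneg_pos)
    define c where "c = gauss_const * \<psi> l * (l powr (b - 1) * (1 - l) powr (real CARD('p) / 2 - b - 1))"
    have c: "0 \<le> c" using \<psi>[OF True] gauss_const_pos by (simp add: c_def)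
    have eq: "\<psi> l * (\<rho> (l, v) * J (l, v)) =
        c * (indicator {0<..} v * (v powr (\<kappa> - 1) * exp (- (r * v))))" for v
    proof (cases "0 < v")
      case v: True
      have "(v / (1 - l)) powr (- real CARD('p) / 2) =
          v powr (- real CARD('p) / 2) * (1 - l) powr (real CARD('p) / 2)"
        using True v by (simp add: powr_divide powr_minus field_simps)
      moreover have "v powr (\<kappa> - 1) = v powr (k + b - 1) * v powr (- real CARD('p) / 2)"
        by (simp add: \<kappa>_def algebra_simps flip: powr_add)
      moreover have "(1 - l) powr (real CARD('p) / 2 - b - 1) =
          (1 - l) powr (- b - 1) * (1 - l) powr (real CARD('p) / 2)"
        by (simp add: algebra_simps flip: powr_add)
      ultimately show ?thesis
        using True v by (simp add: \<rho>_def J_def c_def r_def mult_ac)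
    qed (simp add: \<rho>_eq_0)
    have "(\<integral>\<^sup>+v. ennreal (\<psi> l * (\<rho> (l, v) * J (l, v))) \<partial>lborel) = ennreal c * ennreal (Gamma \<kappa> * r powr (- \<kappa>))"
      unfolding eq ennreal_mult'[OF c]
      by (subst nn_integral_cmult, measurable) (subst nn_integral_powr_exp[OF \<kappa>_pos r], simp)
    also have "\<dots> = ennreal (gauss_const * Gamma \<kappa>) * ennreal (indicator {0<..<1} l * (\<psi> l * wt l))"
      using True gauss_const_pos \<kappa>_pos
      by (simp add: ennreal_mult'[OF c, symmetric] ennreal_mult'[of "gauss_const * Gamma \<kappa>", symmetric])
        (simp add: wt_def c_def r_def mult_ac)
    finally show ?thesis .
  qed (simp add: \<rho>_def)
  have "(\<integral>\<^sup>+w. ennreal (\<psi> (fst w) * (\<rho> w * J w)) \<partial>lborel) =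
      (\<integral>\<^sup>+l. \<integral>\<^sup>+v. ennreal (\<psi> l * (\<rho> (l, v) * J (l, v))) \<partial>lborel \<partial>lborel)"
    unfolding lborel_prod[symmetric]
    by (subst lborel.nn_integral_fst[symmetric]) (simp_all add: lborel_prod)
  then show ?thesis
    unfolding inner by (simp add: nn_integral_cmult)
qed

text \<open>The last factor of \<open>wt\<close> is at most \<open>s powr (- \<kappa>)\<close>, and
  what remains is a Beta integrand with the positive parameters b and p/2 - b.\<close>

lemma integrable_wt:
  assumes [measurable]: "\<psi> \<in> borel_measurable borel" and \<psi>: "\<And>l. l \<in> {0<..<1} \<Longrightarrow> 0 \<le> \<psi> l \<and> \<psi> l \<le> 1"
  shows "integrable lborel (\<lambda>l. indicator {0<..<1} l * (\<psi> l * wt l))"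
proof (rule Bochner_Integration.integrable_bound)
  have "set_integrable lborel {0..1} (\<lambda>l. l powr (b - 1) * (1 - l) powr (real CARD('p) / 2 - b - 1))"
    using b_pos b_less by (intro integrable_Beta) auto
  then show "integrable lborel (\<lambda>l. s powr (- \<kappa>) *
      (indicator {0..1} l *\<^sub>R (l powr (b - 1) * (1 - l) powr (real CARD('p) / 2 - b - 1))))"
    unfolding set_integrable_def by (rule integrable_mult_right)
  show "AE l in lborel. norm (indicator {0<..<1} l * (\<psi> l * wt l)) \<le> norm (s powr (- \<kappa>) *
      (indicator {0..1} l *\<^sub>R (l powr (b - 1) * (1 - l) powr (real CARD('p) / 2 - b - 1))))"
  proof (rule AE_I2)
    fix l
    show "norm (indicator {0<..<1} l * (\<psi> l * wt l)) \<le> norm (s powr (- \<kappa>) *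
      (indicator {0..1} l *\<^sub>R (l powr (b - 1) * (1 - l) powr (real CARD('p) / 2 - b - 1))))"
    proof (cases "l \<in> {0<..<1}")
      case True
      have "(l * mahal d x + s) powr (- \<kappa>) \<le> s powr (- \<kappa>)"
        using True s_pos \<kappa>_pos mahal_nonneg[of x] by (intro powr_mono2') auto
      then have "wt l \<le> (l powr (b - 1) * (1 - l) powr (real CARD('p) / 2 - b - 1)) * s powr (- \<kappa>)"
        unfolding wt_def by (intro mult_left_mono) auto
      moreover have "\<psi> l * wt l \<le> 1 * wt l" "0 \<le> \<psi> l * wt l"
        using \<psi>[OF True] by (intro mult_right_mono mult_nonneg_nonneg; simp add: wt_def)+
      ultimately show ?thesis
        using True by (simp add: abs_mult mult_ac)
    qed simp
  qed
qed measurable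

lemma has_bochner_integral_\<rho>_J:
  assumes [measurable]: "\<psi> \<in> borel_measurable borel" and \<psi>: "\<And>l. l \<in> {0<..<1} \<Longrightarrow> 0 \<le> \<psi> l \<and> \<psi> l \<le> 1"
  shows "has_bochner_integral lborel (\<lambda>w. \<psi> (fst w) * (\<rho> w * J w))
    (gauss_const * Gamma \<kappa> * (\<integral>l. indicator {0<..<1} l * (\<psi> l * wt l) \<partial>lborel))"
proof (rule has_bochner_integral_nn_integral)
  have nn: "0 \<le> indicator {0<..<1} l * (\<psi> l * wt l)" for l
    using \<psi>[of l] by (auto simp: indicator_def wt_def)
  show "0 \<le> gauss_const * Gamma \<kappa> * (\<integral>l. indicator {0<..<1} l * (\<psi> l * wt l) \<partial>lborel)"
    using gauss_const_pos \<kappa>_pos nn by (intro mult_nonneg_nonneg integral_nonneg) auto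
  have "(\<integral>\<^sup>+l. ennreal (indicator {0<..<1} l * (\<psi> l * wt l)) \<partial>lborel) =
      ennreal (\<integral>l. indicator {0<..<1} l * (\<psi> l * wt l) \<partial>lborel)"
    using nn assms by (intro nn_integral_eq_integral integrable_wt) auto
  then show "(\<integral>\<^sup>+w. ennreal (\<psi> (fst w) * (\<rho> w * J w)) \<partial>lborel) =
      ennreal (gauss_const * Gamma \<kappa> * (\<integral>l. indicator {0<..<1} l * (\<psi> l * wt l) \<partial>lborel))"
    using gauss_const_pos \<kappa>_pos assms
    by (subst nn_integral_\<rho>_J) (auto simp: ennreal_mult'[symmetric])
  show "(\<lambda>w. \<psi> (fst w) * (\<rho> w * J w)) \<in> borel_measurable lborel"
    by measurable
  \<comment> \<open>The sign of \<psi> is known only on the open unit interval; elsewhere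
    \<open>\<rho>\<close> vanishes.\<close>
  show "AE w in lborel. 0 \<le> \<psi> (fst w) * (\<rho> w * J w)"
  proof (rule AE_I2)
    fix w :: "real \<times> real"
    show "0 \<le> \<psi> (fst w) * (\<rho> w * J w)"
      using \<psi>[of "fst w"] \<rho>_nonneg[of w] J_nonneg[of w] \<rho>_eq_0[of "fst w" "snd w"]
      by (cases "fst w \<in> {0<..<1}") auto
  qed
qed

text \<open>Tonelli for \<open>\<rho> w * E 1 \<theta> w\<close>: integrating over \<open>w\<close>
  first gives \<open>Gamma b * Gamma k * h \<theta>\<close>, integrating over \<theta> first gives
  \<open>\<rho> w * J w\<close>.\<close>

lemma has_bochner_integral_h:
  "has_bochner_integral lborel h
    (gauss_const * Gamma \<kappa> * (\<integral>l. indicator {0<..<1} l * wt l \<partial>lborel) / (Gamma b * Gamma k))"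
proof -
  define I where "I = gauss_const * Gamma \<kappa> * (\<integral>l. indicator {0<..<1} l * wt l \<partial>lborel)"
  have C: "0 < Gamma b * Gamma k" using b_pos k_pos by simp
  have I0: "0 \<le> I"
    unfolding I_def using gauss_const_pos \<kappa>_pos
    by (intro mult_nonneg_nonneg integral_nonneg) (auto simp: wt_def)
  have "(\<integral>\<^sup>+\<theta>. ennreal (Gamma b * Gamma k * h \<theta>) \<partial>lborel) =
      (\<integral>\<^sup>+\<theta>. \<integral>\<^sup>+w. ennreal (\<rho> w * E 1 \<theta> w) \<partial>lborel \<partial>lborel)"
    \<comment> \<open>The mixture formula excludes the null set \<theta> = 0, where the quadratic
      form gives no decay in \<open>l\<close>.\<close>
    using AE_lborel_singleton[of "0::real^'p"]
    by (intro nn_integral_cong_AE) (auto simp: nn_integral_\<rho>_E elim!: eventually_mono)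
  also have "\<dots> = (\<integral>\<^sup>+w. \<integral>\<^sup>+\<theta>. ennreal (\<rho> w * E 1 \<theta> w) \<partial>lborel \<partial>lborel)"
    by (rule lborel_pair.Fubini'[symmetric]) (simp add: borel_prod)
  also have "\<dots> = (\<integral>\<^sup>+w. ennreal (\<rho> w * J w) \<partial>lborel)"
  proof (rule nn_integral_cong)
    fix w
    have "integrable lborel (\<lambda>\<theta>. \<rho> w * E 1 \<theta> w)" "(\<integral>\<theta>. \<rho> w * E 1 \<theta> w \<partial>lborel) = \<rho> w * J w"
      using has_bochner_integral_\<rho>_E[of w] unfolding has_bochner_integral_iff by blast+
    then show "(\<integral>\<^sup>+\<theta>. ennreal (\<rho> w * E 1 \<theta> w) \<partial>lborel) = ennreal (\<rho> w * J w)"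
      by (subst nn_integral_eq_integral) (simp_all only: AE_I2 mult_nonneg_nonneg \<rho>_nonneg E_nonneg)
  qed
  also have "\<dots> = ennreal I"
    using has_bochner_integral_\<rho>_J[of "\<lambda>_. 1"]
    by (simp add: has_bochner_integral_iff nn_integral_eq_integral \<rho>_nonneg J_nonneg I_def)
  finally have "has_bochner_integral lborel (\<lambda>\<theta>. Gamma b * Gamma k * h \<theta>) I"
    using C h_nonneg I0 by (intro has_bochner_integral_nn_integral) auto
  from has_bochner_integral_divide_zero[OF this, of "Gamma b * Gamma k"]
  show ?thesis using Gamma_real_pos[OF b_pos] Gamma_real_pos[OF k_pos] by (simp add: I_def)
qed

subsection \<open>Convergence of the numerator\<close>

lemma mahal_minus: "mahal d (- \<theta>) = mahal d \<theta>"
  by (simp add: mahal_norm whiten_minus)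

text \<open>With \<open>T = X - (X - T)\<close>, the square of \<open>norm (X - T)\<close> is at
  most \<open>q \<theta>\<close>, and the fixed term \<open>(norm X)\<^sup>2\<close> is absorbed
  through \<open>s \<le> q \<theta>\<close>.\<close>

lemma norm_whiten_sq_le_q: "(norm (whiten d \<theta>))\<^sup>2 \<le> (2 + 2 * mahal d x / s) * q \<theta>"
proof -
  define X T where "X = whiten d x" and "T = whiten d \<theta>"
  have "norm T \<le> norm X + norm (X - T)"
    using norm_triangle_ineq4[of X "X - T"] by simp
  then have "(norm T)\<^sup>2 \<le> (norm X + norm (X - T))\<^sup>2"
    by (intro power_mono) auto
  also have "\<dots> \<le> 2 * (norm X)\<^sup>2 + 2 * (norm (X - T))\<^sup>2"
    using zero_le_power2[of "norm X - norm (X - T)"] by (simp add: power2_eq_square algebra_simps)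
  also have "\<dots> \<le> 2 * (norm X)\<^sup>2 / s * q \<theta> + 2 * q \<theta>"
  proof (rule add_mono)
    have "2 * (norm X)\<^sup>2 = 2 * (norm X)\<^sup>2 / s * s" using s_pos by simp
    also have "\<dots> \<le> 2 * (norm X)\<^sup>2 / s * q \<theta>"
      using s_pos q_ge by (intro mult_left_mono) auto
    finally show "2 * (norm X)\<^sup>2 \<le> 2 * (norm X)\<^sup>2 / s * q \<theta>" .
    show "2 * (norm (X - T))\<^sup>2 \<le> 2 * q \<theta>"
      using s_pos by (simp add: q_def mahal_norm whiten_diff X_def T_def)
  qed
  finally show ?thesis by (simp add: T_def X_def mahal_norm algebra_simps)
qed

text \<open>The quadratic terms of \<open>q \<theta>\<close> and \<open>q (- \<theta>)\<close>
  cancel, leaving a term linear in \<theta>. Multiplied by \<open>norm \<theta>\<close> it is of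
  quadratic growth, which \<open>q\<close> dominates.\<close>

lemma norm_mult_q_diff_le:
  obtains K where "0 \<le> K" "\<And>\<theta>. norm \<theta> * \<bar>q \<theta> - q (- \<theta>)\<bar> \<le> K * q \<theta>"
proof -
  obtain L where L: "0 < L" "\<And>u. norm u \<le> L * norm (whiten d u)"
    using norm_le_norm_whiten[of d] d_pos by blast
  define K where "K = L * 4 * norm (whiten d x) * (2 + 2 * mahal d x / s)"
  have "0 \<le> K"
    unfolding K_def using L(1) s_pos mahal_nonneg[of x] by (intro mult_nonneg_nonneg) auto
  moreover have "norm \<theta> * \<bar>q \<theta> - q (- \<theta>)\<bar> \<le> K * q \<theta>" for \<theta>
  proof -
    define X T where "X = whiten d x" and "T = whiten d \<theta>"
    have "q \<theta> - q (- \<theta>) = (X - T) \<bullet> (X - T) - (X + T) \<bullet> (X + T)"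
      using whiten_minus[of d \<theta>] whiten_diff[of d x "- \<theta>"]
      by (simp add: q_def mahal_norm power2_norm_eq_inner whiten_diff X_def T_def)
    also have "\<dots> = - 4 * (X \<bullet> T)"
      by (simp add: inner_diff_left inner_diff_right inner_add_left inner_add_right inner_commute)
    finally have "\<bar>q \<theta> - q (- \<theta>)\<bar> = 4 * \<bar>X \<bullet> T\<bar>"
      by (simp add: abs_mult)
    also have "\<dots> \<le> 4 * (norm X * norm T)"
      using Cauchy_Schwarz_ineq2[of X T] by simp
    finally have "norm \<theta> * \<bar>q \<theta> - q (- \<theta>)\<bar> \<le> (L * norm T) * (4 * (norm X * norm T))"
      using L(1) by (intro mult_mono) (auto simp: T_def L(2))
    also have "\<dots> = L * 4 * norm X * (norm T)\<^sup>2"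
      by (simp add: power2_eq_square)
    also have "\<dots> \<le> L * 4 * norm X * ((2 + 2 * mahal d x / s) * q \<theta>)"
      unfolding T_def using L(1) by (intro mult_left_mono norm_whiten_sq_le_q) auto
    finally show ?thesis by (simp add: K_def X_def mult_ac)
  qed
  ultimately show ?thesis using that by blast
qed

text \<open>By the mean value bound the difference of exponentials brings out the difference of the
  two values of \<open>q\<close>, which pays for the factor \<open>norm \<theta>\<close>. A factor t
  = v q is left over, and it is absorbed by halving the rate.\<close>

lemma E_diff_bound:
  obtains K where "0 \<le> K"
    "\<And>\<theta> w. norm ((\<rho> w * (E 1 \<theta> w - E 1 (- \<theta>) w)) *\<^sub>R \<theta>) \<le> K * (\<rho> w * E (1/2) \<theta> w + \<rho> w * E (1/2) (- \<theta>) w)"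
proof -
  obtain K where K: "0 \<le> K" "\<And>\<theta>. norm \<theta> * \<bar>q \<theta> - q (- \<theta>)\<bar> \<le> K * q \<theta>"
    using norm_mult_q_diff_le by blast
  \<comment> \<open>The left side is even in \<theta>, so \<open>q (- \<theta>)\<close> may bound it
    as well; each exponential can then be paired with its own \<open>q\<close>.\<close>
  have K': "norm \<theta> * \<bar>q \<theta> - q (- \<theta>)\<bar> \<le> K * q (- \<theta>)" for \<theta>
    using K(2)[of "- \<theta>"] by (simp add: abs_minus_commute)
  have "norm ((\<rho> w * (E 1 \<theta> w - E 1 (- \<theta>) w)) *\<^sub>R \<theta>) \<le> 2 * K * (\<rho> w * E (1/2) \<theta> w + \<rho> w * E (1/2) (- \<theta>) w)"
    for \<theta> w
  proof (cases w)
    case w: (Pair l v)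
    show ?thesis
    proof (cases "0 < l \<and> l < 1 \<and> 0 < v")
      case True
      define t t' r where "t = v * q \<theta>" and "t' = v * q (- \<theta>)" and "r = v * (l / (1 - l) * mahal d \<theta>)"
      have r: "0 \<le> r" using True by (simp add: r_def mahal_nonneg)
      have E: "E 1 \<theta> w = exp (- t) * exp (- r)" "E 1 (- \<theta>) w = exp (- t') * exp (- r)"
        "E (1/2) \<theta> w = exp (- (t / 2)) * exp (- (r / 2))"
        "E (1/2) (- \<theta>) w = exp (- (t' / 2)) * exp (- (r / 2))"
        by (simp_all add: E_def w t_def t'_def r_def mahal_minus algebra_simps add_divide_distrib flip: exp_add)
      have "norm \<theta> * \<bar>exp (- t) - exp (- t')\<bar> \<le> norm \<theta> * (\<bar>t - t'\<bar> * (exp (- t) + exp (- t')))"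
        by (intro mult_left_mono abs_exp_minus_diff_le) auto
      also have "\<bar>t - t'\<bar> = v * \<bar>q \<theta> - q (- \<theta>)\<bar>"
        using True by (simp add: t_def t'_def abs_mult flip: right_diff_distrib)
      also have "norm \<theta> * (v * \<bar>q \<theta> - q (- \<theta>)\<bar> * (exp (- t) + exp (- t'))) =
          v * (norm \<theta> * \<bar>q \<theta> - q (- \<theta>)\<bar>) * exp (- t) + v * (norm \<theta> * \<bar>q \<theta> - q (- \<theta>)\<bar>) * exp (- t')"
        by (simp add: algebra_simps)
      also have "\<dots> \<le> v * (K * q \<theta>) * exp (- t) + v * (K * q (- \<theta>)) * exp (- t')"
        using True K K' by (intro add_mono mult_right_mono mult_left_mono) auto
      also have "\<dots> = K * (t * exp (- t) + t' * exp (- t'))"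
        by (simp add: t_def t'_def algebra_simps)
      also have "\<dots> \<le> K * (2 * exp (- (t / 2)) + 2 * exp (- (t' / 2)))"
        using K by (intro mult_left_mono add_mono mult_exp_minus_le_half) auto
      finally have "norm \<theta> * \<bar>exp (- t) - exp (- t')\<bar> * exp (- r) \<le>
          K * (2 * exp (- (t / 2)) + 2 * exp (- (t' / 2))) * exp (- (r / 2))"
        by (rule mult_mono) (use K r in auto)
      then have "\<rho> w * (norm \<theta> * \<bar>exp (- t) - exp (- t')\<bar> * exp (- r)) \<le>
          \<rho> w * (K * (2 * exp (- (t / 2)) + 2 * exp (- (t' / 2))) * exp (- (r / 2)))"
        using \<rho>_nonneg by (intro mult_left_mono)
      moreover have "norm ((\<rho> w * (E 1 \<theta> w - E 1 (- \<theta>) w)) *\<^sub>R \<theta>) =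
          \<rho> w * (norm \<theta> * \<bar>exp (- t) - exp (- t')\<bar> * exp (- r))"
      proof -
        have "E 1 \<theta> w - E 1 (- \<theta>) w = (exp (- t) - exp (- t')) * exp (- r)"
          by (simp add: E algebra_simps)
        then show ?thesis using \<rho>_nonneg[of w] by (simp add: abs_mult)
      qed
      ultimately show ?thesis
        by (simp add: E algebra_simps)
    qed (simp add: w \<rho>_eq_0)
  qed
  then show ?thesis using that[of "2 * K"] K(1) by simp
qed

text \<open>Integrating over \<open>w\<close> first leaves a multiple of
  \<open>h (c *\<^sub>R \<theta>)\<close>. The values \<open>c = 1\<close> and \<open>c = -1\<close>
  give the two terms of the dominating function.\<close>

lemma integrable_\<rho>_E_pair:
  assumes \<tau>: "0 < \<tau>" and c: "c \<noteq> 0"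
  shows "integrable (lborel \<Otimes>\<^sub>M lborel) (\<lambda>(\<theta>, w). \<rho> w * E \<tau> (c *\<^sub>R \<theta>) w)"
proof (rule integrableI_nonneg)
  show "(\<lambda>(\<theta>, w). \<rho> w * E \<tau> (c *\<^sub>R \<theta>) w) \<in> borel_measurable (lborel \<Otimes>\<^sub>M lborel)"
    by measurable
  show "AE z in lborel \<Otimes>\<^sub>M lborel. 0 \<le> (case z of (\<theta>, w) \<Rightarrow> \<rho> w * E \<tau> (c *\<^sub>R \<theta>) w)"
    by (rule AE_I2) (auto simp: \<rho>_nonneg E_nonneg)
  have "(\<integral>\<^sup>+z. ennreal (case z of (\<theta>, w) \<Rightarrow> \<rho> w * E \<tau> (c *\<^sub>R \<theta>) w) \<partial>(lborel \<Otimes>\<^sub>M lborel)) =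
      (\<integral>\<^sup>+\<theta>. \<integral>\<^sup>+w. ennreal (\<rho> w * E \<tau> (c *\<^sub>R \<theta>) w) \<partial>lborel \<partial>lborel)"
    by (subst lborel.nn_integral_fst[symmetric]) simp_all
  also have "\<dots> = (\<integral>\<^sup>+\<theta>. ennreal (Gamma b * Gamma k * \<tau> powr (- (b + k)) * h (c *\<^sub>R \<theta>)) \<partial>lborel)"
    using AE_lborel_singleton[of "0::real^'p"] c \<tau>
    by (intro nn_integral_cong_AE) (auto simp: nn_integral_\<rho>_E elim!: eventually_mono)
  also have "\<dots> < \<infinity>"
  proof -
    have "integrable lborel (\<lambda>\<theta>. h (0 + c *\<^sub>R \<theta>))"
      using lborel_has_bochner_integral_affine[OF has_bochner_integral_h c, of 0]
      unfolding has_bochner_integral_iff by blast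
    then have "integrable lborel (\<lambda>\<theta>. Gamma b * Gamma k * \<tau> powr (- (b + k)) * h (c *\<^sub>R \<theta>))"
      by (intro integrable_mult_right) simp
    moreover have "0 \<le> Gamma b * Gamma k * \<tau> powr (- (b + k)) * h (c *\<^sub>R \<theta>)" for \<theta>
      using b_pos k_pos h_nonneg by simp
    ultimately show ?thesis
      by (subst nn_integral_eq_integral) auto
  qed
  finally show "(\<integral>\<^sup>+z. ennreal (case z of (\<theta>, w) \<Rightarrow> \<rho> w * E \<tau> (c *\<^sub>R \<theta>) w) \<partial>(lborel \<Otimes>\<^sub>M lborel)) < \<infinity>" .
qed

lemma integrable_\<rho>_E_diff:
  "integrable (lborel \<Otimes>\<^sub>M lborel) (\<lambda>(\<theta>, w). (\<rho> w * (E 1 \<theta> w - E 1 (- \<theta>) w)) *\<^sub>R \<theta>)"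
proof -
  obtain K where K: "0 \<le> K"
    "\<And>\<theta> w. norm ((\<rho> w * (E 1 \<theta> w - E 1 (- \<theta>) w)) *\<^sub>R \<theta>) \<le> K * (\<rho> w * E (1/2) \<theta> w + \<rho> w * E (1/2) (- \<theta>) w)"
    using E_diff_bound by blast
  show ?thesis
  proof (rule Bochner_Integration.integrable_bound)
    show "integrable (lborel \<Otimes>\<^sub>M lborel) (\<lambda>z. K * ((case z of (\<theta>, w) \<Rightarrow> \<rho> w * E (1/2) (1 *\<^sub>R \<theta>) w) +
        (case z of (\<theta>, w) \<Rightarrow> \<rho> w * E (1/2) ((-1) *\<^sub>R \<theta>) w)))"
      by (intro integrable_mult_right Bochner_Integration.integrable_add integrable_\<rho>_E_pair) auto
    show "AE z in lborel \<Otimes>\<^sub>M lborel. norm (case z of (\<theta>, w) \<Rightarrow> (\<rho> w * (E 1 \<theta> w - E 1 (- \<theta>) w)) *\<^sub>R \<theta>) \<le>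
      norm (K * ((case z of (\<theta>, w) \<Rightarrow> \<rho> w * E (1/2) (1 *\<^sub>R \<theta>) w) +
        (case z of (\<theta>, w) \<Rightarrow> \<rho> w * E (1/2) ((-1) *\<^sub>R \<theta>) w)))"
    proof (rule AE_I2)
      fix z :: "(real^'p) \<times> real \<times> real"
      obtain \<theta> w where z: "z = (\<theta>, w)" by (cases z)
      have "0 \<le> K * (\<rho> w * E (1/2) \<theta> w + \<rho> w * E (1/2) (- \<theta>) w)"
        using K(1) by (intro mult_nonneg_nonneg add_nonneg_nonneg \<rho>_nonneg E_nonneg)
      then show "norm (case z of (\<theta>, w) \<Rightarrow> (\<rho> w * (E 1 \<theta> w - E 1 (- \<theta>) w)) *\<^sub>R \<theta>) \<le>
        norm (K * ((case z of (\<theta>, w) \<Rightarrow> \<rho> w * E (1/2) (1 *\<^sub>R \<theta>) w) +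
          (case z of (\<theta>, w) \<Rightarrow> \<rho> w * E (1/2) ((-1) *\<^sub>R \<theta>) w)))"
        using K(2)[of w \<theta>] unfolding z prod.case by (simp only: scaleR_one scaleR_minus1_left real_norm_def abs_of_nonneg)
    qed
  qed measurable
qed

lemma has_bochner_integral_\<rho>_E_inner:
  assumes "\<theta> \<noteq> 0"
  shows "has_bochner_integral lborel (\<lambda>w. \<rho> w * E 1 \<theta> w) (Gamma b * Gamma k * h \<theta>)"
  using nn_integral_\<rho>_E[OF assms, of 1] b_pos k_pos h_nonneg
  by (intro has_bochner_integral_nn_integral) (auto simp: \<rho>_nonneg E_nonneg)

text \<open>Fubini is legitimate for the antisymmetrised kernel. In the integral over \<theta> for
  fixed \<open>w\<close>, the term with \<open>- \<theta>\<close> contributes as much as the other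
  one, by reflection; hence the factor 2.\<close>

lemma has_bochner_integral_h_antisym:
  "has_bochner_integral lborel (\<lambda>\<theta>. (h \<theta> - h (- \<theta>)) *\<^sub>R \<theta>)
    ((2 * (gauss_const * Gamma \<kappa> * (\<integral>l. indicator {0<..<1} l * ((1 - l) * wt l) \<partial>lborel)) / (Gamma b * Gamma k)) *\<^sub>R x)"
proof -
  let ?F = "\<lambda>\<theta> w. (\<rho> w * (E 1 \<theta> w - E 1 (- \<theta>) w)) *\<^sub>R \<theta>"
  define S where "S = gauss_const * Gamma \<kappa> * (\<integral>l. indicator {0<..<1} l * ((1 - l) * wt l) \<partial>lborel)"
  define C where "C = Gamma b * Gamma k"
  have C: "0 < C" using b_pos k_pos by (simp add: C_def)
  have inner: "(\<integral>w. ?F \<theta> w \<partial>lborel) = C *\<^sub>R ((h \<theta> - h (- \<theta>)) *\<^sub>R \<theta>)" for \<theta>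
  proof (cases "\<theta> = 0")
    case False
    have "has_bochner_integral lborel (\<lambda>w. (\<rho> w * E 1 \<theta> w - \<rho> w * E 1 (- \<theta>) w) *\<^sub>R \<theta>)
        ((C * h \<theta> - C * h (- \<theta>)) *\<^sub>R \<theta>)"
      unfolding C_def using False
      by (intro has_bochner_integral_scaleR_left has_bochner_integral_diff has_bochner_integral_\<rho>_E_inner) auto
    then show ?thesis
      by (simp add: has_bochner_integral_iff algebra_simps)
  qed simp
  have outer: "(\<integral>\<theta>. ?F \<theta> w \<partial>lborel) = (2 * ((1 - fst w) * (\<rho> w * J w))) *\<^sub>R x" for w
  proof -
    let ?G = "\<lambda>\<theta>. (\<rho> w * E 1 \<theta> w) *\<^sub>R \<theta>"
    let ?I = "((1 - fst w) * (\<rho> w * J w)) *\<^sub>R x"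
    have 1: "has_bochner_integral lborel ?G ?I" by (rule has_bochner_integral_\<rho>_E_scaleR)
    from lborel_has_bochner_integral_affine[OF this, of "-1" 0]
    have 2: "has_bochner_integral lborel (\<lambda>\<theta>. ?G (- \<theta>)) ?I" by simp
    have "has_bochner_integral lborel (\<lambda>\<theta>. ?G \<theta> + ?G (- \<theta>)) (?I + ?I)"
      by (rule has_bochner_integral_add[OF 1 2])
    moreover have "?G \<theta> + ?G (- \<theta>) = ?F \<theta> w" for \<theta>
      by (simp add: algebra_simps)
    ultimately show ?thesis
      by (simp add: has_bochner_integral_iff flip: scaleR_add_left)
  qed
  have 1: "integrable lborel (\<lambda>\<theta>. \<integral>w. ?F \<theta> w \<partial>lborel)"
    using lborel_pair.integrable_fst[OF integrable_\<rho>_E_diff] by simp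
  have "(\<integral>\<theta>. (\<integral>w. ?F \<theta> w \<partial>lborel) \<partial>lborel) = (\<integral>w. (\<integral>\<theta>. ?F \<theta> w \<partial>lborel) \<partial>lborel)"
    using integrable_\<rho>_E_diff by (rule lborel_pair.Fubini_integral[symmetric])
  also have "\<dots> = (2 * S) *\<^sub>R x"
  proof -
    have "has_bochner_integral lborel (\<lambda>w. (1 - fst w) * (\<rho> w * J w)) S"
      unfolding S_def by (rule has_bochner_integral_\<rho>_J) auto
    then have "has_bochner_integral lborel (\<lambda>w. (2 * ((1 - fst w) * (\<rho> w * J w))) *\<^sub>R x) ((2 * S) *\<^sub>R x)"
      by (intro has_bochner_integral_scaleR_left has_bochner_integral_mult_right)
    then show ?thesis unfolding outer by (simp add: has_bochner_integral_iff)
  qed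
  finally have "has_bochner_integral lborel (\<lambda>\<theta>. C *\<^sub>R ((h \<theta> - h (- \<theta>)) *\<^sub>R \<theta>)) ((2 * S) *\<^sub>R x)"
    using 1 unfolding inner has_bochner_integral_iff by blast
  then have "has_bochner_integral lborel (\<lambda>\<theta>. (1 / C) *\<^sub>R (C *\<^sub>R ((h \<theta> - h (- \<theta>)) *\<^sub>R \<theta>))) ((1 / C) *\<^sub>R ((2 * S) *\<^sub>R x))"
    by (intro has_bochner_integral_scaleR_right)
  then show ?thesis
    using Gamma_real_pos[OF b_pos] Gamma_real_pos[OF k_pos] by (simp add: S_def C_def)
qed

lemma cball_borel [measurable]: "cball (0::real^'p) R \<in> sets borel"
  by (intro borel_closed) simp

lemma integrable_h_ball: "integrable lborel (\<lambda>\<theta>. indicator (cball 0 R) \<theta> *\<^sub>R (h \<theta> *\<^sub>R \<theta>))"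
proof (rule Bochner_Integration.integrable_bound)
  show "integrable lborel (\<lambda>\<theta>. \<bar>R\<bar> * h \<theta>)"
    using has_bochner_integral_h by (intro integrable_mult_right) (auto simp: has_bochner_integral_iff)
  show "AE \<theta> in lborel. norm (indicator (cball 0 R) \<theta> *\<^sub>R (h \<theta> *\<^sub>R \<theta>)) \<le> norm (\<bar>R\<bar> * h \<theta>)"
    by (rule AE_I2) (auto simp: indicator_def abs_mult h_nonneg mult.commute intro!: mult_right_mono)
qed measurable

lemma tendsto_integral_h_ball:
  "((\<lambda>R. \<integral>\<theta>. indicator (cball 0 R) \<theta> *\<^sub>R (h \<theta> *\<^sub>R \<theta>) \<partial>lborel) \<longlongrightarrow>
    (gauss_const * Gamma \<kappa> * (\<integral>l. indicator {0<..<1} l * ((1 - l) * wt l) \<partial>lborel) / (Gamma b * Gamma k)) *\<^sub>R x) at_top"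
proof -
  let ?A = "\<lambda>\<theta>. (h \<theta> - h (- \<theta>)) *\<^sub>R \<theta>"
  have A: "integrable lborel ?A"
    using has_bochner_integral_h_antisym unfolding has_bochner_integral_iff by blast
  \<comment> \<open>The ball is invariant under reflection, so the integral may be averaged with its
    reflected copy. The averaged integrand has an integrable majorant that does not depend on
    \<open>R\<close>.\<close>
  have sym: "(\<integral>\<theta>. indicator (cball 0 R) \<theta> *\<^sub>R (h \<theta> *\<^sub>R \<theta>) \<partial>lborel) =
      (1/2) *\<^sub>R (\<integral>\<theta>. indicator (cball 0 R) \<theta> *\<^sub>R ?A \<theta> \<partial>lborel)" for R
  proof -
    let ?G = "\<lambda>\<theta>. indicator (cball 0 R) \<theta> *\<^sub>R (h \<theta> *\<^sub>R \<theta>)"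
    have 1: "has_bochner_integral lborel ?G (integral\<^sup>L lborel ?G)"
      by (intro has_bochner_integral_integrable integrable_h_ball)
    from lborel_has_bochner_integral_affine[OF this, of "-1" 0]
    have 2: "has_bochner_integral lborel (\<lambda>\<theta>. ?G (- \<theta>)) (integral\<^sup>L lborel ?G)" by simp
    have "has_bochner_integral lborel (\<lambda>\<theta>. ?G \<theta> + ?G (- \<theta>)) (integral\<^sup>L lborel ?G + integral\<^sup>L lborel ?G)"
      by (rule has_bochner_integral_add[OF 1 2])
    moreover have "?G \<theta> + ?G (- \<theta>) = indicator (cball 0 R) \<theta> *\<^sub>R ?A \<theta>" for \<theta>
      by (simp add: indicator_def algebra_simps)
    ultimately have "(\<integral>\<theta>. indicator (cball 0 R) \<theta> *\<^sub>R ?A \<theta> \<partial>lborel) = 2 *\<^sub>R integral\<^sup>L lborel ?G"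
      by (simp add: has_bochner_integral_iff scaleR_2)
    then show ?thesis by simp
  qed
  have "((\<lambda>R. \<integral>\<theta>. indicator (cball 0 R) \<theta> *\<^sub>R ?A \<theta> \<partial>lborel) \<longlongrightarrow> integral\<^sup>L lborel ?A) at_top"
  proof (rule integral_dominated_convergence_at_top[where w = "\<lambda>\<theta>. norm (?A \<theta>)"])
    show "AE \<theta> in lborel. ((\<lambda>R. indicator (cball 0 R) \<theta> *\<^sub>R ?A \<theta>) \<longlongrightarrow> ?A \<theta>) at_top"
    proof (rule AE_I2, rule tendsto_eventually)
      fix \<theta> :: "real^'p"
      show "\<forall>\<^sub>F R in at_top. indicator (cball 0 R) \<theta> *\<^sub>R ?A \<theta> = ?A \<theta>"
        using eventually_ge_at_top[of "norm \<theta>"] by eventually_elim auto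
    qed
    show "\<forall>\<^sub>F R in at_top. AE \<theta> in lborel. norm (indicator (cball 0 R) \<theta> *\<^sub>R ?A \<theta>) \<le> norm (?A \<theta>)"
      by (intro always_eventually allI AE_I2) (simp add: indicator_def)
  qed (use A in measurable, intro integrable_norm A)
  then have "((\<lambda>R. (1/2) *\<^sub>R (\<integral>\<theta>. indicator (cball 0 R) \<theta> *\<^sub>R ?A \<theta> \<partial>lborel)) \<longlongrightarrow> (1/2) *\<^sub>R integral\<^sup>L lborel ?A) at_top"
    by (intro tendsto_scaleR tendsto_const)
  moreover have "(1/2) *\<^sub>R integral\<^sup>L lborel ?A = (gauss_const * Gamma \<kappa> *
      (\<integral>l. indicator {0<..<1} l * ((1 - l) * wt l) \<partial>lborel) / (Gamma b * Gamma k)) *\<^sub>R x"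
    using has_bochner_integral_h_antisym unfolding has_bochner_integral_iff by (simp add: mult_ac)
  ultimately show ?thesis unfolding sym by simp
qed

end

subsection \<open>The scale integral\<close>

text \<open>Rescaling by \<open>r\<close> costs \<open>r powr (- m)\<close> from the weight and one
  more power from du. For \<open>m = k - 1\<close> and \<open>r = q \<theta>\<close> this is the
  factor \<open>q \<theta> powr (- k)\<close> of \<open>h\<close>.\<close>

lemma nn_integral_powr_scale:
  fixes F :: "real \<Rightarrow> real"
  assumes [measurable]: "F \<in> borel_measurable borel" and r: "0 < r"
  shows "(\<integral>\<^sup>+u. ennreal (indicator {0<..} u * (u powr m * F (u * r))) \<partial>lborel) =
    ennreal (r powr (- (m + 1))) * (\<integral>\<^sup>+u. ennreal (indicator {0<..} u * (u powr m * F u)) \<partial>lborel)"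
proof -
  have "(\<integral>\<^sup>+u. ennreal (indicator {0<..} u * (u powr m * F u)) \<partial>lborel) =
      ennreal r * (\<integral>\<^sup>+u. ennreal (indicator {0<..} (r * u) * ((r * u) powr m * F (r * u))) \<partial>lborel)"
    using r by (subst nn_integral_real_affine[where t = 0 and c = r]) auto
  also have "\<dots> = ennreal r * (\<integral>\<^sup>+u. ennreal (r powr m) * ennreal (indicator {0<..} u * (u powr m * F (u * r))) \<partial>lborel)"
    using r by (intro arg_cong2[where f = "(*)"] refl nn_integral_cong)
      (auto simp: indicator_def powr_mult zero_less_mult_iff mult_ac simp flip: ennreal_mult')
  also have "\<dots> = ennreal (r powr (m + 1)) * (\<integral>\<^sup>+u. ennreal (indicator {0<..} u * (u powr m * F (u * r))) \<partial>lborel)"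
    using r by (subst nn_integral_cmult)
      (auto simp: mult.assoc[symmetric] ennreal_mult'[symmetric] powr_mult_base add.commute)
  finally have *: "(\<integral>\<^sup>+u. ennreal (indicator {0<..} u * (u powr m * F u)) \<partial>lborel) =
     ennreal (r powr (m + 1)) * (\<integral>\<^sup>+u. ennreal (indicator {0<..} u * (u powr m * F (u * r))) \<partial>lborel)" .
  show ?thesis
    unfolding * using r by (simp add: mult.assoc[symmetric] ennreal_mult'[symmetric] powr_add[symmetric])
qed

section \<open>The integrals over \<open>l\<close> and the estimator\<close>

context elliptical
begin

text \<open>\<open>I\<^sub>1 / I\<^sub>0\<close> is the mean of \<open>l\<close> under the density
  proportional to \<open>wt\<close>, and turns out to be the shrinkage factor.\<close>

definition I\<^sub>0 :: real where "I\<^sub>0 = (\<integral>l. indicator {0<..<1} l * wt l \<partial>lborel)"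
definition I\<^sub>1 :: real where "I\<^sub>1 = (\<integral>l. indicator {0<..<1} l * (l * wt l) \<partial>lborel)"

lemma integral_one_minus_wt: "(\<integral>l. indicator {0<..<1} l * ((1 - l) * wt l) \<partial>lborel) = I\<^sub>0 - I\<^sub>1"
proof -
  have "integrable lborel (\<lambda>l. indicator {0<..<1} l * wt l)"
    using integrable_wt[of "\<lambda>_. 1"] by simp
  moreover have "integrable lborel (\<lambda>l. indicator {0<..<1} l * (l * wt l))"
    by (rule integrable_wt) auto
  ultimately have "I\<^sub>0 - I\<^sub>1 = (\<integral>l. indicator {0<..<1} l * wt l - indicator {0<..<1} l * (l * wt l) \<partial>lborel)"
    unfolding I\<^sub>0_def I\<^sub>1_def by simp
  then show ?thesis by (simp add: algebra_simps)
qed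

lemma wt_pos: "0 < l \<Longrightarrow> l < 1 \<Longrightarrow> 0 < wt l"
proof -
  assume "0 < l" "l < 1"
  then have "0 < l * mahal d x + s"
    using s_pos mahal_nonneg[of x] by (intro add_nonneg_pos) auto
  then show ?thesis using \<open>0 < l\<close> \<open>l < 1\<close> by (simp add: wt_def)
qed

lemma I\<^sub>0_pos: "0 < I\<^sub>0"
proof -
  have int: "integrable lborel (\<lambda>l. indicator {0<..<1} l * wt l)"
    using integrable_wt[of "\<lambda>_. 1"] by simp
  have nn: "0 \<le> indicator {0<..<1} l * wt l" for l by (simp add: wt_def)
  have "I\<^sub>0 \<noteq> 0"
  proof
    assume "I\<^sub>0 = 0"
    then have "AE l in lborel. indicator {0<..<1} l * wt l = 0"
      unfolding I\<^sub>0_def using int nn by (subst (asm) integral_nonneg_eq_0_iff_AE) auto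
    then have "AE l::real in lborel. l \<notin> {0<..<1}"
      by eventually_elim (use wt_pos in \<open>force simp: indicator_def\<close>)
    then have "emeasure lborel {0<..<1::real} = 0"
      by (subst (asm) AE_iff_measurable[of "{0<..<1}"]) auto
    then show False by simp
  qed
  moreover have "0 \<le> I\<^sub>0" unfolding I\<^sub>0_def using nn by (intro Bochner_Integration.integral_nonneg)
  ultimately show ?thesis by linarith
qed

text \<open>As \<open>norm \<theta>\<close> is at most a multiple of
  \<open>sqrt (q \<theta>)\<close>, it merely replaces \<open>k\<close> by \<open>k - 1/2\<close>.
  For the new exponent, \<open>k_large\<close> reads exactly \<open>1/2 < \<kappa>\<close>.\<close>

lemma integrable_h_norm:
  assumes "1/2 < \<kappa>"
  shows "integrable lborel (\<lambda>\<theta>. h \<theta> * norm \<theta>)"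
proof -
  interpret half: elliptical d x s b "k - 1/2"
    using assms d_pos s_pos b_pos b_less by unfold_locales (auto simp: \<kappa>_def)
  obtain L where L: "0 < L" "\<And>u. norm u \<le> L * norm (whiten d u)"
    using norm_le_norm_whiten[of d] d_pos by blast
  define A where "A = 2 + 2 * mahal d x / s"
  have A: "0 < A" using s_pos mahal_nonneg[of x] by (simp add: A_def add_pos_nonneg)
  show ?thesis
  proof (rule Bochner_Integration.integrable_bound)
    show "integrable lborel (\<lambda>\<theta>. L * sqrt A * half.h \<theta>)"
      using half.has_bochner_integral_h by (intro integrable_mult_right) (auto simp: has_bochner_integral_iff)
    show "AE \<theta> in lborel. norm (h \<theta> * norm \<theta>) \<le> norm (L * sqrt A * half.h \<theta>)"
    proof (rule AE_I2)
      fix \<theta> :: "real^'p"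
      have "norm (whiten d \<theta>) \<le> sqrt (A * q \<theta>)"
        unfolding A_def by (intro real_le_rsqrt norm_whiten_sq_le_q)
      then have "norm \<theta> \<le> L * (sqrt A * sqrt (q \<theta>))"
        using L(1) L(2)[of \<theta>] by (auto simp: real_sqrt_mult intro: order_trans mult_left_mono)
      then have "h \<theta> * norm \<theta> \<le> h \<theta> * (L * (sqrt A * sqrt (q \<theta>)))"
        by (intro mult_left_mono h_nonneg)
      also have "h \<theta> * sqrt (q \<theta>) = half.h \<theta>"
      proof -
        have "q \<theta> powr (- (k - 1/2)) = q \<theta> powr (- k) * sqrt (q \<theta>)"
          using q_pos[of \<theta>] by (simp add: powr_half_sqrt[symmetric] algebra_simps flip: powr_add)
        then show ?thesis by (simp add: h_def half.h_def half.q_def q_def)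
      qed
      then have "h \<theta> * (L * (sqrt A * sqrt (q \<theta>))) = L * sqrt A * half.h \<theta>"
        by (simp add: mult_ac)
      finally show "norm (h \<theta> * norm \<theta>) \<le> norm (L * sqrt A * half.h \<theta>)"
        using L(1) A h_nonneg[of \<theta>] half.h_nonneg[of \<theta>] by (simp add: abs_mult)
    qed
  qed measurable
qed

text \<open>For this \<kappa> there is a product of powers of l, 1 - l and l m + s, with exponents
  summing to 0, whose derivative is \<open>wt\<close> times a polynomial in l. The quadratic terms
  of that polynomial cancel, so integration gives a linear relation between \<open>I\<^sub>0\<close>
  and \<open>I\<^sub>1\<close>.\<close>

lemma I\<^sub>1_eq:
  assumes \<kappa>: "\<kappa> = real CARD('p) / 2 + 1"
  shows "I\<^sub>1 = s * b / (s * (real CARD('p) / 2) + (real CARD('p) / 2 - b) * mahal d x) * I\<^sub>0"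
proof -
  define c m where "c = real CARD('p) / 2 - b" and "m = mahal d x"
  have c: "0 < c" using b_less by (simp add: c_def)
  have m: "0 \<le> m" by (simp add: m_def mahal_nonneg)
  have bc: "real CARD('p) / 2 = b + c" by (simp add: c_def)
  have wt: "wt l = l powr (b - 1) * (1 - l) powr (c - 1) * (l * m + s) powr (- (b + c) - 1)" for l
    unfolding wt_def \<kappa> by (simp add: c_def m_def)
  \<comment> \<open>The integrand \<open>(s b - (s (b + c) + c m) l) * wt l\<close> is the derivative of \<open>P\<close>, which vanishes at \<open>0\<close> and \<open>1\<close>.\<close>
  define P where "P l = l powr b * (1 - l) powr c * (l * m + s) powr (- (b + c))" for l
  have "((\<lambda>l. (s * b - (s * (b + c) + c * m) * l) * wt l) has_integral (P 1 - P 0)) {0..1}"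
  proof (rule fundamental_theorem_of_calculus_interior)
    show "continuous_on {0..1} P"
      unfolding P_def using b_pos c s_pos m
      by (intro continuous_intros continuous_on_powr')
        (auto intro: add_nonneg_nonneg simp: add_nonneg_eq_0_iff less_imp_neq)
    show "(P has_vector_derivative (s * b - (s * (b + c) + c * m) * l) * wt l) (at l)"
      if l: "l \<in> {0<..<1}" for l
    proof -
      have pos: "0 < l" "0 < 1 - l" "0 < l * m + s" using l m s_pos by (auto intro: add_nonneg_pos)
      \<comment> \<open>Splitting off one power from each factor makes the remaining identity
        polynomial.\<close>
      have e: "l powr b = l * l powr (b - 1)" "(1 - l) powr c = (1 - l) * (1 - l) powr (c - 1)"
        "(l * m + s) powr (- (b + c)) = (l * m + s) * (l * m + s) powr (- (b + c) - 1)"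
        using pos by (simp_all add: powr_mult_base)
      have "(P has_real_derivative
          (b * l powr (b - 1)) * (1 - l) powr c * (l * m + s) powr (- (b + c)) +
          l powr b * (- c * (1 - l) powr (c - 1)) * (l * m + s) powr (- (b + c)) +
          l powr b * (1 - l) powr c * (- (b + c) * (l * m + s) powr (- (b + c) - 1) * m)) (at l)"
        unfolding P_def[abs_def] using pos
        by (auto intro!: derivative_eq_intros DERIV_fun_powr simp: algebra_simps)
      also have "(b * l powr (b - 1)) * (1 - l) powr c * (l * m + s) powr (- (b + c)) +
          l powr b * (- c * (1 - l) powr (c - 1)) * (l * m + s) powr (- (b + c)) +
          l powr b * (1 - l) powr c * (- (b + c) * (l * m + s) powr (- (b + c) - 1) * m) =
          (s * b - (s * (b + c) + c * m) * l) * wt l"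
        unfolding e wt by algebra
      finally show ?thesis by (simp add: has_real_derivative_iff_has_vector_derivative)
    qed
  qed simp
  then have "((\<lambda>l. (s * b - (s * (b + c) + c * m) * l) * wt l) has_integral 0) {0<..<1}"
    using b_pos c by (simp add: P_def has_integral_Icc_iff_Ioo)
  then have "integral {0<..<1} (\<lambda>l. (s * b - (s * (b + c) + c * m) * l) * wt l) = 0"
    by (rule integral_unique)
  moreover have "integral {0<..<1} (\<lambda>l. (s * b - (s * (b + c) + c * m) * l) * wt l) =
      s * b * I\<^sub>0 - (s * (b + c) + c * m) * I\<^sub>1"
  proof -
    have "has_bochner_integral lborel (\<lambda>l. indicator {0<..<1} l * wt l) I\<^sub>0"
      using integrable_wt[of "\<lambda>_. 1"] by (simp add: has_bochner_integral_iff I\<^sub>0_def)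
    moreover have "has_bochner_integral lborel (\<lambda>l. indicator {0<..<1} l * (l * wt l)) I\<^sub>1"
      using integrable_wt[of "\<lambda>l. l"] by (simp add: has_bochner_integral_iff I\<^sub>1_def)
    ultimately have "has_bochner_integral lborel
        (\<lambda>l. s * b * (indicator {0<..<1} l * wt l) - (s * (b + c) + c * m) * (indicator {0<..<1} l * (l * wt l)))
        (s * b * I\<^sub>0 - (s * (b + c) + c * m) * I\<^sub>1)"
      by (intro has_bochner_integral_diff has_bochner_integral_mult_right)
    moreover have "s * b * (indicator {0<..<1} l * wt l) - (s * (b + c) + c * m) * (indicator {0<..<1} l * (l * wt l)) =
        indicator {0<..<1} l *\<^sub>R ((s * b - (s * (b + c) + c * m) * l) * wt l)" for l
      by (simp add: algebra_simps)
    ultimately have "has_bochner_integral lborel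
        (\<lambda>l. indicator {0<..<1} l *\<^sub>R ((s * b - (s * (b + c) + c * m) * l) * wt l))
        (s * b * I\<^sub>0 - (s * (b + c) + c * m) * I\<^sub>1)"
      by (simp only:)
    then have "set_integrable lborel {0<..<1} (\<lambda>l. (s * b - (s * (b + c) + c * m) * l) * wt l)"
      "set_lebesgue_integral lborel {0<..<1} (\<lambda>l. (s * b - (s * (b + c) + c * m) * l) * wt l) =
        s * b * I\<^sub>0 - (s * (b + c) + c * m) * I\<^sub>1"
      unfolding has_bochner_integral_iff set_integrable_def set_lebesgue_integral_def by blast+
    then show ?thesis
      using set_borel_integral_eq_integral(2) by fastforce
  qed
  ultimately have "s * b * I\<^sub>0 - (s * (b + c) + c * m) * I\<^sub>1 = 0"
    by simp
  moreover have "0 < s * (b + c) + c * m"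
    using s_pos b_pos c m by (intro add_pos_nonneg) auto
  ultimately show ?thesis
    unfolding bc m_def[symmetric] c_def[symmetric] by (simp add: field_simps)
qed

text \<open>The profile \<open>f\<close> enters only through its moment \<open>M\<close>: the
  integral over \<eta> is \<open>c * M * h \<theta>\<close>, and \<open>c * M\<close> cancels. The
  lemma serves both the given profile and the Gaussian one.\<close>

lemma gb_of_moment:
  fixes f :: "real \<Rightarrow> real" and w :: "real^'p \<Rightarrow> real \<Rightarrow> real"
  assumes meas_f: "(\<lambda>u. indicator {0<..} u * f u) \<in> borel_measurable borel"
    and f_nonneg: "\<And>u. 0 < u \<Longrightarrow> 0 \<le> f u"
    and moment: "has_bochner_integral lborel (\<lambda>\<eta>. indicator {0<..} \<eta> * (\<eta> powr (k - 1) * f \<eta>)) M"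
    and M: "0 < M" and c: "0 < c"
    and w: "\<And>\<theta> \<eta>. 0 < \<eta> \<Longrightarrow> \<eta> * w \<theta> \<eta> = c * (mahal d \<theta> powr (- b) * (\<eta> powr (k - 1) * f (\<eta> * q \<theta>)))"
  shows "gb_well_defined w" "gb_estimator w = (1 - I\<^sub>1 / I\<^sub>0) *\<^sub>R x" "1/2 < \<kappa> \<Longrightarrow> gb_absolute w"
proof -
  \<comment> \<open>Measurability and sign of \<open>f\<close> are given only on the positive
    half-line, hence the extension by 0.\<close>
  define F where "F u = indicator {0<..} u * f u" for u
  have [measurable]: "F \<in> borel_measurable borel" using meas_f by (simp add: F_def[abs_def])
  have F0: "0 \<le> F u" for u using f_nonneg[of u] by (simp add: F_def indicator_def)
  define H where "H \<theta> \<eta> = indicator {0<..} \<eta> * (\<eta> * w \<theta> \<eta>)" for \<theta> \<eta>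
  have H: "H \<theta> \<eta> = c * mahal d \<theta> powr (- b) * (indicator {0<..} \<eta> * (\<eta> powr (k - 1) * F (\<eta> * q \<theta>)))" for \<theta> \<eta>
    using q_pos[of \<theta>] by (auto simp: H_def w F_def indicator_def zero_less_mult_iff)
  have [measurable]: "case_prod H \<in> borel_measurable (lborel \<Otimes>\<^sub>M lborel)"
    unfolding H by measurable
  have H0: "0 \<le> H \<theta> \<eta>" for \<theta> \<eta> unfolding H using c F0 by simp
  have nnM: "(\<integral>\<^sup>+\<eta>. ennreal (indicator {0<..} \<eta> * (\<eta> powr (k - 1) * F \<eta>)) \<partial>lborel) = ennreal M"
  proof -
    have eq: "indicator {0<..} \<eta> * (\<eta> powr (k - 1) * F \<eta>) = indicator {0<..} \<eta> * (\<eta> powr (k - 1) * f \<eta>)" for \<eta>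
      by (simp add: F_def indicator_def)
    have "integrable lborel (\<lambda>\<eta>. indicator {0<..} \<eta> * (\<eta> powr (k - 1) * F \<eta>))"
      "(\<integral>\<eta>. indicator {0<..} \<eta> * (\<eta> powr (k - 1) * F \<eta>) \<partial>lborel) = M"
      using moment unfolding eq has_bochner_integral_iff by blast+
    then show ?thesis by (subst nn_integral_eq_integral) (auto simp: F0)
  qed
  have inner: "has_bochner_integral lborel (H \<theta>) (c * M * h \<theta>)" for \<theta>
  proof (rule has_bochner_integral_nn_integral)
    have "(\<integral>\<^sup>+\<eta>. ennreal (H \<theta> \<eta>) \<partial>lborel) = ennreal (c * mahal d \<theta> powr (- b)) *
        (ennreal (q \<theta> powr (- (k - 1 + 1))) * ennreal M)"
    proof -
      have C: "0 \<le> c * mahal d \<theta> powr (- b)" using c by simp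
      show ?thesis
        unfolding H ennreal_mult'[OF C]
        by (subst nn_integral_cmult, measurable) (simp only: nn_integral_powr_scale[OF \<open>F \<in> borel_measurable borel\<close> q_pos] nnM)
    qed
    also have "\<dots> = ennreal (c * M * h \<theta>)"
      using c M by (simp add: ennreal_mult'[symmetric] h_def mult_ac)
    finally show "(\<integral>\<^sup>+\<eta>. ennreal (H \<theta> \<eta>) \<partial>lborel) = ennreal (c * M * h \<theta>)" .
  qed (use c M h_nonneg H0 in \<open>auto simp: less_imp_le\<close>)
  \<comment> \<open>Taking for \<psi> the constant 1, the vector \<theta> cut off to a ball, and
    \<theta> itself gives the denominator, the truncated numerator and absolute convergence.\<close>
  have pair: "has_bochner_integral lborel (\<lambda>(\<theta>, \<eta>). H \<theta> \<eta> *\<^sub>R \<psi> \<theta>) ((c * M) *\<^sub>R (\<integral>\<theta>. h \<theta> *\<^sub>R \<psi> \<theta> \<partial>lborel))"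
    if [measurable]: "\<psi> \<in> borel_measurable borel" and int: "integrable lborel (\<lambda>\<theta>. h \<theta> * norm (\<psi> \<theta>))"
    for \<psi> :: "real^'p \<Rightarrow> 'v::{banach, second_countable_topology}"
  proof -
    let ?G = "\<lambda>(\<theta>, \<eta>). H \<theta> \<eta> *\<^sub>R \<psi> \<theta>"
    have norm: "has_bochner_integral lborel (\<lambda>\<eta>. norm (?G (\<theta>, \<eta>))) (c * M * (h \<theta> * norm (\<psi> \<theta>)))" for \<theta>
      using has_bochner_integral_mult_left[OF inner[of \<theta>], of "norm (\<psi> \<theta>)"] by (simp add: H0 mult_ac)
    have vec: "has_bochner_integral lborel (\<lambda>\<eta>. ?G (\<theta>, \<eta>)) ((c * M) *\<^sub>R (h \<theta> *\<^sub>R \<psi> \<theta>))" for \<theta>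
      using has_bochner_integral_scaleR_left[OF inner[of \<theta>], of "\<psi> \<theta>"] by simp
    have 1: "integrable (lborel \<Otimes>\<^sub>M lborel) ?G"
    proof (rule lborel_pair.Fubini_integrable)
      show "integrable lborel (\<lambda>\<theta>. \<integral>\<eta>. norm (?G (\<theta>, \<eta>)) \<partial>lborel)"
      proof -
        have "(\<integral>\<eta>. norm (?G (\<theta>, \<eta>)) \<partial>lborel) = c * M * (h \<theta> * norm (\<psi> \<theta>))" for \<theta>
          using norm[of \<theta>] unfolding has_bochner_integral_iff by blast
        then show ?thesis using int by (simp only: integrable_mult_right)
      qed
      show "AE \<theta> in lborel. integrable lborel (\<lambda>\<eta>. ?G (\<theta>, \<eta>))"
        using vec unfolding has_bochner_integral_iff by blast
    qed measurable
    have "integral\<^sup>L (lborel \<Otimes>\<^sub>M lborel) ?G = (\<integral>\<theta>. (\<integral>\<eta>. ?G (\<theta>, \<eta>) \<partial>lborel) \<partial>lborel)"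
      using lborel_pair.integral_fst'[OF 1] by simp
    also have "\<dots> = (\<integral>\<theta>. (c * M) *\<^sub>R (h \<theta> *\<^sub>R \<psi> \<theta>) \<partial>lborel)"
      using vec unfolding has_bochner_integral_iff by presburger
    also have "\<dots> = (c * M) *\<^sub>R (\<integral>\<theta>. h \<theta> *\<^sub>R \<psi> \<theta> \<partial>lborel)"
      by (rule integral_scaleR_right)
    finally show ?thesis
      using 1 by (simp add: has_bochner_integral_iff lborel_prod)
  qed
  have ind: "indicator (A \<times> {0<..}) z *\<^sub>R (case z of (\<theta>, \<eta>) \<Rightarrow> (\<eta> * w \<theta> \<eta>) *\<^sub>R \<theta>) =
      (case z of (\<theta>, \<eta>) \<Rightarrow> H \<theta> \<eta> *\<^sub>R (indicator A \<theta> *\<^sub>R \<theta>))" for A z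
    by (auto simp: H_def indicator_def split: prod.split)
  have ind1: "indicator (UNIV \<times> {0<..}) z *\<^sub>R (case z of (\<theta>, \<eta>) \<Rightarrow> \<eta> * w \<theta> \<eta>) =
      (case z of (\<theta>, \<eta>) \<Rightarrow> H \<theta> \<eta> *\<^sub>R 1)" for z :: "(real^'p) \<times> real"
    by (auto simp: H_def indicator_def split: prod.split)
  define Z where "Z = gauss_const * Gamma \<kappa> / (Gamma b * Gamma k)"
  have Z: "0 < Z" using gauss_const_pos \<kappa>_pos b_pos k_pos by (simp add: Z_def)
  have hint: "integrable lborel h" "integral\<^sup>L lborel h = Z * I\<^sub>0"
    using has_bochner_integral_h by (auto simp: has_bochner_integral_iff Z_def I\<^sub>0_def)
  have den: "has_bochner_integral lborel (\<lambda>(\<theta>, \<eta>). H \<theta> \<eta> *\<^sub>R (1::real)) (c * M * (Z * I\<^sub>0))"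
    using pair[of "\<lambda>_. 1::real"] hint by simp
  have ball: "has_bochner_integral lborel (\<lambda>(\<theta>, \<eta>). H \<theta> \<eta> *\<^sub>R (indicator (cball 0 R) \<theta> *\<^sub>R \<theta>))
      ((c * M) *\<^sub>R (\<integral>\<theta>. indicator (cball 0 R) \<theta> *\<^sub>R (h \<theta> *\<^sub>R \<theta>) \<partial>lborel))" for R
  proof -
    have "integrable lborel (\<lambda>\<theta>. h \<theta> * norm (indicator (cball 0 R) \<theta> *\<^sub>R \<theta>))"
      using integrable_norm[OF integrable_h_ball[of R]] by (simp add: h_nonneg mult_ac)
    then show ?thesis
      using pair[of "\<lambda>\<theta>. indicator (cball 0 R) \<theta> *\<^sub>R \<theta>"] by (simp add: mult.commute)
  qed
  have d_int: "set_integrable lborel (UNIV \<times> {0<..}) (\<lambda>(\<theta>, \<eta>). \<eta> * w \<theta> \<eta>)"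
    using den unfolding set_integrable_def ind1 has_bochner_integral_iff by blast
  have d_val: "gb_denominator w = c * M * (Z * I\<^sub>0)"
    using den unfolding gb_denominator_def set_lebesgue_integral_def ind1 has_bochner_integral_iff by blast
  have d_pos: "0 < gb_denominator w"
    unfolding d_val using c M Z I\<^sub>0_pos by simp
  have n_int: "set_integrable lborel (cball 0 R \<times> {0<..}) (\<lambda>(\<theta>, \<eta>). (\<eta> * w \<theta> \<eta>) *\<^sub>R \<theta>)" for R
    using ball unfolding set_integrable_def ind has_bochner_integral_iff by blast
  have n_val: "gb_numerator w = (\<lambda>R. (c * M) *\<^sub>R (\<integral>\<theta>. indicator (cball 0 R) \<theta> *\<^sub>R (h \<theta> *\<^sub>R \<theta>) \<partial>lborel))"
    using ball unfolding gb_numerator_def[abs_def] set_lebesgue_integral_def ind has_bochner_integral_iff by blast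
  have n_lim: "(gb_numerator w \<longlongrightarrow> (c * M) *\<^sub>R ((Z * (I\<^sub>0 - I\<^sub>1)) *\<^sub>R x)) at_top"
    unfolding n_val using tendsto_integral_h_ball
    by (intro tendsto_scaleR tendsto_const) (simp add: Z_def integral_one_minus_wt)
  show "gb_well_defined w"
    unfolding gb_well_defined_def using d_int d_pos n_int n_lim by blast
  have L: "Lim at_top (gb_numerator w) = (c * M) *\<^sub>R ((Z * (I\<^sub>0 - I\<^sub>1)) *\<^sub>R x)"
    using n_lim by (intro tendsto_Lim) auto
  have "1 / (c * M * (Z * I\<^sub>0)) * (c * M * (Z * (I\<^sub>0 - I\<^sub>1))) = 1 - I\<^sub>1 / I\<^sub>0"
    using c M Z I\<^sub>0_pos by (simp add: field_simps)
  then show "gb_estimator w = (1 - I\<^sub>1 / I\<^sub>0) *\<^sub>R x"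
    unfolding gb_estimator_def d_val L scaleR_scaleR by simp
  show "gb_absolute w" if "1/2 < \<kappa>"
    using pair[of "\<lambda>\<theta>. \<theta>", OF _ integrable_h_norm[OF that]]
    unfolding gb_absolute_def set_integrable_def ind has_bochner_integral_iff by simp
qed

text \<open>Taking \<open>s\<close> out of \<open>l * mahal d x + s\<close> leaves 1 + W l, and both
  integrals acquire the same power of \<open>s\<close>, which cancels in their quotient.\<close>

lemma shrink_integral_eq:
  assumes \<kappa>: "\<kappa> = real CARD('p) / 2 + n / 2 + e + 2" and b: "b = real CARD('p) / 2 + a + 1"
  shows "I\<^sub>0 = s powr (- \<kappa>) * shrink_integral (real CARD('p) / 2 + a) (real CARD('p)) n a e (mahal d x / s)" (is ?I0)
    and "I\<^sub>1 = s powr (- \<kappa>) * shrink_integral (real CARD('p) / 2 + a + 1) (real CARD('p)) n a e (mahal d x / s)" (is ?I1)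
proof -
  have wt: "wt l = s powr (- \<kappa>) * (l powr (real CARD('p) / 2 + a) * (1 - l) powr (- a - 2) *
      (1 + mahal d x / s * l) powr (- real CARD('p) / 2 - n / 2 - e - 2))" if "0 < l" for l
  proof -
    have "l * mahal d x + s = s * (1 + mahal d x / s * l)"
      using s_pos by (simp add: field_simps)
    then have "(l * mahal d x + s) powr (- \<kappa>) = s powr (- \<kappa>) * (1 + mahal d x / s * l) powr (- \<kappa>)"
      using s_pos mahal_nonneg[of x] that by (simp add: powr_mult)
    moreover have "- real CARD('p) / 2 - n / 2 - e - 2 = - \<kappa>" "real CARD('p) / 2 + a = b - 1"
      "- a - 2 = real CARD('p) / 2 - b - 1"
      using \<kappa> b by auto
    ultimately show ?thesis by (simp only: wt_def mult_ac)
  qed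
  show ?I0
    \<comment> \<open>The closed and the open interval give the same integrand, as
      \<open>0 powr _ = 0\<close> at both endpoints.\<close>
    unfolding I\<^sub>0_def shrink_integral_def set_lebesgue_integral_def
    by (subst integral_mult_right_zero[symmetric], rule Bochner_Integration.integral_cong)
      (auto simp: indicator_def wt)
  have "l * l powr (real CARD('p) / 2 + a) = l powr (real CARD('p) / 2 + a + 1)" if "0 < l" for l :: real
    using that by (simp add: powr_mult_base add_ac)
  then show ?I1
    unfolding I\<^sub>1_def shrink_integral_def set_lebesgue_integral_def
    by (subst integral_mult_right_zero[symmetric], intro Bochner_Integration.integral_cong)
      (auto simp: indicator_def wt mult.left_commute[of _ "s powr (- \<kappa>)"] mult.assoc[symmetric])
qed

end

subsection \<open>The theorem\<close>

text \<open>The estimator needs a positive denominator, hence a positive moment; this comes from the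
  model densities having total mass one.\<close>

lemma moment_pos:
  fixes d :: "'p::finite \<Rightarrow> real" and f :: "real \<Rightarrow> real"
  assumes d: "\<And>i. 0 < d i"
    and f_density: "\<And>\<eta>. 0 < \<eta> \<Longrightarrow>
      is_prob_density (\<lambda>(x::real^'p, z::real^'n::finite). model_density d f 0 \<eta> x z)"
    and meas_f: "(\<lambda>u. indicator {0<..} u * f u) \<in> borel_measurable borel"
  shows "(\<integral>\<^sup>+u. ennreal (indicator {0<..} u * (u powr m * f u)) \<partial>lborel) \<noteq> 0"
proof
  define F where "F u = indicator {0<..} u * f u" for u
  have [measurable]: "F \<in> borel_measurable borel" using meas_f by (simp add: F_def[abs_def])
  have [measurable]: "mahal d \<in> borel_measurable borel"
    unfolding mahal_eq_norm[OF d, abs_def] by measurable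
  define r where "r y = mahal d (fst y) + snd y \<bullet> snd y" for y :: "(real^'p) \<times> (real^'n)"
  have [measurable]: "r \<in> borel_measurable (lborel :: ((real^'p) \<times> (real^'n)) measure)"
    unfolding r_def[abs_def] lborel_prod[symmetric] by measurable
  have rpos: "0 < r y" if "y \<noteq> 0" for y
    using that mahal_pos[where d = d and \<theta> = "fst y", OF d] mahal_eq_norm[where d = d and x = "fst y", OF d]
    by (cases "fst y = 0") (auto simp: r_def prod_eq_iff intro: add_pos_nonneg add_nonneg_pos)
  assume 0: "(\<integral>\<^sup>+u. ennreal (indicator {0<..} u * (u powr m * f u)) \<partial>lborel) = 0"
  have "(\<integral>\<^sup>+u. ennreal (indicator {0<..} u * (u powr m * F u)) \<partial>lborel) = 0"
    unfolding 0[symmetric] by (intro nn_integral_cong) (simp add: F_def indicator_def)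
  then have inner: "(\<integral>\<^sup>+u. ennreal (indicator {0<..} u * (u powr m * F (u * r y))) \<partial>lborel) = 0"
    if "y \<noteq> 0" for y
    using nn_integral_powr_scale[OF \<open>F \<in> borel_measurable borel\<close> rpos[OF that], of m] by simp
  \<comment> \<open>If the moment vanished, then so would \<open>\<integral>\<integral> u powr m * f (u * r y)\<close>, by rescaling \<open>u\<close>; but for each \<open>u\<close>
    the inner integral is a positive multiple of the total mass of the density.\<close>
  have "(\<integral>\<^sup>+u. \<integral>\<^sup>+y. ennreal (indicator {0<..} u * (u powr m * F (u * r y))) \<partial>lborel \<partial>lborel) =
      (\<integral>\<^sup>+y. \<integral>\<^sup>+u. ennreal (indicator {0<..} u * (u powr m * F (u * r y))) \<partial>lborel \<partial>lborel)"
    by (rule lborel_pair.Fubini') measurable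
  also have "\<dots> = (\<integral>\<^sup>+y. 0 \<partial>(lborel :: ((real^'p) \<times> (real^'n)) measure))"
    using AE_lborel_singleton[of "0 :: (real^'p) \<times> (real^'n)"]
    by (intro nn_integral_cong_AE) (auto simp: inner elim!: eventually_mono)
  finally have "(\<integral>\<^sup>+u. \<integral>\<^sup>+y. ennreal (indicator {0<..} u * (u powr m * F (u * r y))) \<partial>lborel \<partial>lborel) = 0"
    by simp
  then have AE: "AE u in lborel. (\<integral>\<^sup>+y. ennreal (indicator {0<..} u * (u powr m * F (u * r y))) \<partial>lborel) = 0"
    by (subst (asm) nn_integral_0_iff_AE) auto
  have nz: "(\<integral>\<^sup>+y. ennreal (indicator {0<..} u * (u powr m * F (u * r y))) \<partial>lborel) \<noteq> 0" if u: "0 < u" for u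
  proof
    assume "(\<integral>\<^sup>+y. ennreal (indicator {0<..} u * (u powr m * F (u * r y))) \<partial>lborel) = 0"
    then have "AE y in lborel. ennreal (indicator {0<..} u * (u powr m * F (u * r y))) = 0"
      by (subst (asm) nn_integral_0_iff_AE) auto
    then have "AE y in lborel. ennreal (case y of (x, z :: real^'n) \<Rightarrow> model_density d f 0 u x z) = 0"
      using AE_lborel_singleton[of "0 :: (real^'p) \<times> (real^'n)"]
    proof eventually_elim
      case (elim y)
      have neg: "mahal d (- v) = mahal d v" for v
        by (simp add: mahal_eq_norm[OF d] whiten_minus)
      have "f (u * r y) \<le> 0"
        using elim u rpos[of y] by (auto simp: F_def mult_le_0_iff ennreal_eq_0_iff)
      then have "model_density d f 0 u (fst y) (snd y) \<le> 0"
        using u by (auto simp: model_density_def r_def neg intro!: mult_nonneg_nonpos mult_nonneg_nonneg prod_nonneg)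
      then show ?case by (simp add: split_beta ennreal_eq_0_iff)
    qed
    then have "(\<integral>\<^sup>+y. ennreal (case y of (x, z :: real^'n) \<Rightarrow> model_density d f 0 u x z) \<partial>lborel) =
        (\<integral>\<^sup>+y. 0 \<partial>(lborel :: ((real^'p) \<times> (real^'n)) measure))"
      by (rule nn_integral_cong_AE)
    with f_density[OF u] show False by (simp add: is_prob_density_def)
  qed
  from AE have "AE u::real in lborel. u \<notin> {0<..}"
    by eventually_elim (use nz in auto)
  then have "emeasure lborel {0<..<1::real} = 0"
    by (intro AE_iff_measurable[THEN iffD1, of "{0<..<1}" lborel "\<lambda>u. u \<notin> {0<..<1}"]) (auto elim: eventually_mono)
  then show False by simp
qed

lemma alpha_image:
  assumes "0 < p"
  shows "alpha p ` {- p / 2 - 1 <..< -1} = {0<..}"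
proof (intro set_eqI iffI)
  fix y :: real assume "y \<in> {0<..}"
  then have y: "0 < y" by simp
  \<comment> \<open>The solution of \<open>alpha p (- 1 - t) = y\<close>, that is, of (p/2 - t) / t
    = y.\<close>
  define t where "t = p / (2 * (1 + y))"
  have t: "0 < t" "p / 2 = t * (1 + y)"
    using y assms by (auto simp: t_def field_simps)
  have "alpha p (- 1 - t) = (t * (1 + y) - t) / t"
    by (simp add: alpha_def flip: t(2))
  also have "\<dots> = y" using t(1) by (simp add: field_simps)
  finally have "y = alpha p (- 1 - t)" ..
  moreover have "t < p / 2"
    unfolding t(2) using t(1) y by simp
  ultimately show "y \<in> alpha p ` {- p / 2 - 1 <..< -1}"
    using t(1) by (intro image_eqI[of _ _ "- 1 - t"]) auto
qed (auto simp: alpha_def)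

theorem mainTheorem5:
  fixes d :: "'p::{finite,linorder} \<Rightarrow> real" and f :: "real \<Rightarrow> real" and a e c :: real
  assumes d_decreasing: "antimono d" and d_pos: "\<And>i. 0 < d i"
    and f_nonneg: "\<And>t. 0 \<le> t \<Longrightarrow> 0 \<le> f t"
    and f_density: "\<And>(\<theta>::(real, 'p) vec) \<eta>. 0 < \<eta> \<Longrightarrow>
      is_prob_density (\<lambda>(x::(real, 'p) vec, z::real^'n::finite). model_density d f \<theta> \<eta> x z)"
    and a_range: "- real CARD('p) / 2 - 1 < a" "a < -1"
    and e_range: "- real CARD('p) / 2 - real CARD('n) / 2 - 2 < e"
    and c_pos: "0 < c"
    and f_moment: "set_integrable lborel {0<..}
      (\<lambda>\<eta>. \<eta> powr ((real CARD('n) + real CARD('p)) / 2 - a + e) * f \<eta>)"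
  shows "(\<forall>(x::(real, 'p) vec) (z::real^'n). z \<noteq> 0 \<longrightarrow>
      (let p = real CARD('p); n = real CARD('n); W = W_stat d x z;
           K = posterior_kernel d f a e c x z;
           G = posterior_kernel d (gauss_profile (CARD('p) + CARD('n))) a e c x z
       in gb_well_defined K \<and> gb_well_defined G \<and>
          (- p / 2 - n / 2 - 3 / 2 < e \<longrightarrow> gb_absolute K \<and> gb_absolute G) \<and>
          gb_estimator K = gb_estimator G \<and>
          gb_estimator K = (1 - phi p n a e W / W) *\<^sub>R x \<and>
          (e = - n / 2 - 1 \<longrightarrow>
            gb_estimator K = (1 - alpha p a / (alpha p a + 1 + W)) *\<^sub>R x)))
    \<and> alpha (real CARD('p)) ` {- real CARD('p) / 2 - 1 <..< -1} = {0<..}"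
proof (intro conjI allI impI)
  define p n where "p = real CARD('p)" and "n = real CARD('n)"
  define m where "m = (n + p) / 2 - a + e"
  define b k where "b = p / 2 + a + 1" and "k = m + 1"
  have fm: "set_integrable lborel {0<..} (\<lambda>\<eta>. \<eta> powr m * f \<eta>)"
    using f_moment by (simp add: m_def n_def p_def)
  \<comment> \<open>The moment condition makes \<open>u powr m * f u\<close> measurable on the
    positive half-line, and the power can be divided out.\<close>
  have meas_f: "(\<lambda>u. indicator {0<..} u * f u) \<in> borel_measurable borel"
  proof -
    have [measurable]: "(\<lambda>u. indicator {0<..} u * (u powr m * f u)) \<in> borel_measurable borel"
      using borel_measurable_integrable[OF fm[unfolded set_integrable_def]] by simp
    have "(\<lambda>u. u powr (- m) * (indicator {0<..} u * (u powr m * f u))) \<in> borel_measurable borel"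
      by measurable
    also have "(\<lambda>u. u powr (- m) * (indicator {0<..} u * (u powr m * f u))) = (\<lambda>u. indicator {0<..} u * f u)"
      by (auto simp: indicator_def powr_minus field_simps)
    finally show ?thesis .
  qed
  obtain M where M: "0 < M"
    "has_bochner_integral lborel (\<lambda>\<eta>. indicator {0<..} \<eta> * (\<eta> powr (k - 1) * f \<eta>)) M"
  proof
    let ?g = "\<lambda>\<eta>. indicator {0<..} \<eta> * (\<eta> powr m * f \<eta>)"
    have int: "integrable lborel ?g"
      using fm by (simp add: set_integrable_def)
    then show "has_bochner_integral lborel (\<lambda>\<eta>. indicator {0<..} \<eta> * (\<eta> powr (k - 1) * f \<eta>)) (integral\<^sup>L lborel ?g)"
      by (simp add: k_def has_bochner_integral_integrable)
    have nn: "0 \<le> ?g \<eta>" for \<eta> using f_nonneg[of \<eta>] by (simp add: indicator_def)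
    have "ennreal (integral\<^sup>L lborel ?g) \<noteq> 0"
      using moment_pos[of d f m, OF d_pos f_density meas_f] nn int
      by (subst nn_integral_eq_integral[symmetric]) auto
    then show "0 < integral\<^sup>L lborel ?g"
      by (simp add: ennreal_eq_0_iff)
  qed
  let ?g = "gauss_profile (CARD('p) + CARD('n))"
  define C where "C = (2 * pi) powr (- real (CARD('p) + CARD('n)) / 2)"
  have C: "0 < C" by (simp add: C_def)
  show "alpha (real CARD('p)) ` {- real CARD('p) / 2 - 1 <..< -1} = {0<..}"
    by (rule alpha_image) simp
  fix x :: "(real, 'p) vec" and z :: "(real, 'n) vec" assume z: "z \<noteq> 0"
  \<comment> \<open>The two bounds on \<open>a\<close> are \<open>0 < b\<close> and
    \<open>b < p / 2\<close>. As k + b = p + n/2 + e + 2, the bound on \<open>e\<close> is exactly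
    \<open>k_large\<close>.\<close>
  interpret elliptical d x "z \<bullet> z" b k
    using z a_range e_range d_pos
    by unfold_locales (auto simp: b_def k_def m_def p_def n_def field_simps)
  have \<kappa>: "\<kappa> = p / 2 + n / 2 + e + 2"
    unfolding \<kappa>_def p_def[symmetric] by (simp add: b_def k_def m_def field_simps)
  define W where "W = W_stat d x z"
  have W: "W = mahal d x / (z \<bullet> z)" by (simp add: W_def W_stat_def)
  define c' where "c' = (\<Prod>i\<in>UNIV. d i powr (-1/2)) * c"
  have c': "0 < c'" unfolding c'_def using d_pos c_pos by (intro mult_pos_pos prod_pos) (auto simp: less_imp_neq[symmetric])
  \<comment> \<open>The powers of \<eta> from the loss, the model and the prior are 1, (p + n)/2 and
    -a - 1 + e; they add up to \<open>k - 1\<close>.\<close>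
  have kernel: "\<eta> * posterior_kernel d u a e c x z \<theta> \<eta> =
      c' * (mahal d \<theta> powr (- b) * (\<eta> powr (k - 1) * u (\<eta> * q \<theta>)))" if "0 < \<eta>" for u \<theta> \<eta>
  proof -
    have "\<eta> powr (k - 1) = \<eta> * (\<eta> powr ((p + n) / 2) * \<eta> powr (- a - 1 + e))"
      using that by (simp add: powr_mult_base k_def m_def field_simps flip: powr_add)
    moreover have "- b = - p / 2 - a - 1" by (simp add: b_def)
    ultimately show ?thesis
      by (simp add: posterior_kernel_def model_density_def prior_density_def c'_def q_def p_def n_def mult_ac)
  qed
  have gauss: "has_bochner_integral lborel (\<lambda>\<eta>. indicator {0<..} \<eta> * (\<eta> powr (k - 1) * ?g \<eta>))
      (C * (Gamma k * (1/2) powr (- k)))"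
  proof -
    have "has_bochner_integral lborel (\<lambda>\<eta>. indicator {0<..} \<eta> * (\<eta> powr (k - 1) * exp (- (1/2 * \<eta>))))
        (Gamma k * (1/2) powr (- k))"
      using k_pos nn_integral_powr_exp[OF k_pos, of "1/2"]
      by (intro has_bochner_integral_nn_integral) auto
    from has_bochner_integral_mult_right[OF this, of C]
    show ?thesis by (simp add: gauss_profile_def C_def mult_ac)
  qed
  have Kf: "gb_well_defined (posterior_kernel d f a e c x z)"
    "gb_estimator (posterior_kernel d f a e c x z) = (1 - I\<^sub>1 / I\<^sub>0) *\<^sub>R x"
    "1/2 < \<kappa> \<Longrightarrow> gb_absolute (posterior_kernel d f a e c x z)"
    using gb_of_moment[where f = f and w = "posterior_kernel d f a e c x z",
        OF meas_f f_nonneg[OF less_imp_le] M(2) M(1) c' kernel] by blast+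
  have Kg: "gb_well_defined (posterior_kernel d ?g a e c x z)"
    "gb_estimator (posterior_kernel d ?g a e c x z) = (1 - I\<^sub>1 / I\<^sub>0) *\<^sub>R x"
    "1/2 < \<kappa> \<Longrightarrow> gb_absolute (posterior_kernel d ?g a e c x z)"
  proof -
    have 1: "(\<lambda>u. indicator {0<..} u * ?g u) \<in> borel_measurable borel"
      unfolding gauss_profile_def[abs_def] by measurable
    have 2: "0 < C * (Gamma k * (1/2) powr (- k))"
      using C k_pos by simp
    have 3: "0 \<le> ?g u" for u
      by (simp add: gauss_profile_def)
    show "gb_well_defined (posterior_kernel d ?g a e c x z)"
      "gb_estimator (posterior_kernel d ?g a e c x z) = (1 - I\<^sub>1 / I\<^sub>0) *\<^sub>R x"
      "1/2 < \<kappa> \<Longrightarrow> gb_absolute (posterior_kernel d ?g a e c x z)"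
      using gb_of_moment[where f = ?g and w = "posterior_kernel d ?g a e c x z",
          OF 1 3 gauss 2 c' kernel] by blast+
  qed
  \<comment> \<open>If \<open>x = 0\<close> then \<open>W = 0\<close> and the quotient by
    \<open>W\<close> is a division by zero, but both sides vanish as multiples of
    \<open>x\<close>.\<close>
  have ratio: "(1 - I\<^sub>1 / I\<^sub>0) *\<^sub>R x = (1 - phi p n a e W / W) *\<^sub>R x"
  proof (cases "x = 0")
    case False
    then have "W \<noteq> 0"
      using mahal_pos[where d = d and \<theta> = x, OF d_pos] z by (simp add: W less_imp_neq[symmetric])
    moreover have "I\<^sub>1 / I\<^sub>0 = shrink_integral (p / 2 + a + 1) p n a e W / shrink_integral (p / 2 + a) p n a e W"
      using shrink_integral_eq[of n e a] \<kappa> s_pos by (simp add: b_def p_def W)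
    ultimately show ?thesis by (simp add: phi_def)
  qed simp
  have closed: "(1 - I\<^sub>1 / I\<^sub>0) *\<^sub>R x = (1 - alpha p a / (alpha p a + 1 + W)) *\<^sub>R x" if "e = - n / 2 - 1"
  proof -
    \<comment> \<open>This is \<open>- a - 1\<close>, the denominator of \<open>alpha\<close>, whose
      numerator is \<open>b\<close>. The given \<open>e\<close> makes \<kappa> equal to p/2 + 1, as
      the closed form for \<open>I\<^sub>1\<close> requires.\<close>
    define g where "g = p / 2 - b"
    have g: "0 < g" using b_less by (simp add: g_def p_def)
    have p2: "p / 2 = b + g" by (simp add: g_def)
    have W0: "0 \<le> W" using mahal_nonneg[of x] s_pos by (simp add: W)
    have "I\<^sub>1 = (z \<bullet> z) * b / ((z \<bullet> z) * (p / 2) + g * mahal d x) * I\<^sub>0"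
      using I\<^sub>1_eq \<kappa> that by (simp add: p_def g_def)
    moreover have "mahal d x = W * (z \<bullet> z)" using s_pos by (simp add: W)
    moreover have "(z \<bullet> z) * (p / 2) + g * (W * (z \<bullet> z)) = (z \<bullet> z) * (b + g + g * W)"
      by (simp add: p2 algebra_simps)
    ultimately have "I\<^sub>1 = (z \<bullet> z) * b / ((z \<bullet> z) * (b + g + g * W)) * I\<^sub>0"
      by (simp only:)
    then have "I\<^sub>1 / I\<^sub>0 = (z \<bullet> z) * b / ((z \<bullet> z) * (b + g + g * W))"
      using I\<^sub>0_pos by (metis less_irrefl nonzero_mult_div_cancel_right)
    also have "\<dots> = b / (b + g + g * W)"
      using s_pos by simp
    also have "\<dots> = alpha p a / (alpha p a + 1 + W)"
    proof -
      have "alpha p a = b / g" by (simp add: alpha_def b_def g_def)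
      moreover have "b / g + 1 + W = (b + g + g * W) / g" using g by (simp add: field_simps)
      ultimately show ?thesis using g by simp
    qed
    finally show ?thesis by simp
  qed
  have half: "1/2 < \<kappa>" if "- p / 2 - n / 2 - 3 / 2 < e"
    using that by (simp add: \<kappa>)
  show "let p = real CARD('p); n = real CARD('n); W = W_stat d x z;
           K = posterior_kernel d f a e c x z;
           G = posterior_kernel d (gauss_profile (CARD('p) + CARD('n))) a e c x z
       in gb_well_defined K \<and> gb_well_defined G \<and>
          (- p / 2 - n / 2 - 3 / 2 < e \<longrightarrow> gb_absolute K \<and> gb_absolute G) \<and>
          gb_estimator K = gb_estimator G \<and>
          gb_estimator K = (1 - phi p n a e W / W) *\<^sub>R x \<and>
          (e = - n / 2 - 1 \<longrightarrow>
            gb_estimator K = (1 - alpha p a / (alpha p a + 1 + W)) *\<^sub>R x)"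
    unfolding Let_def p_def[symmetric] n_def[symmetric] W_def[symmetric]
    using Kf Kg half ratio closed by metis
qed

end
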